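(* Let $S$ be a finitely generated, commutative, reduced and cancellative semigroup with zero element, minimally generated by a disjoint union $A_1\sqcup A_2$ of nonempty finite sets $A_1=\{a_1,\dots,a_r\}$ and $A_2=\{b_1,\dots,b_t\}$. Suppose that $S$ is the gluing of $S_1=\langle A_1\rangle$ and $S_2=\langle A_2\rangle$, and let $X^{\gamma_X}-Y^{\gamma_Y}\in I_S$ be a glued binomial, with $S$-degree $d$. Then the ideal $I_S$ is minimally generated by its indispensable binomials if and only if the following conditions are fulfilled: (i) The ideals $I_{S_1}$ and $I_{S_2}$ are minimally generated by their indispensable binomials. (ii) $X^{\gamma_X}-Y^{\gamma_Y}$ is an indispensable binomial of $I_S$. (iii) For all $d'\in Betti(S)$, the elements of $C_{d'}$ are pure monomials.
   Context: Semigroups are commutative with zero. $S$ is cancellative if $m+n=m+n'$ implies $n=n'$, and reduced if $S\cap(-S)=\{0\}$; $S$ need not be torsion-free. "Minimally generated" (for $S$) means no proper subset of the generating set generates $S$. Let $\Bbbk$ be a field. The polynomial ring $\Bbbk[X_1,\dots,X_r,Y_1,\dots,Y_t]$ is $S$-graded by giving $X_i$ degree $a_i$ and $Y_j$ degree $b_j$. The semigroup ideal $I_S$ is the ($S$-homogeneous) ideal generated by all differences of two monomials of the same $S$-degree; $I_{S_1}\subset\Bbbk[X_1,\dots,X_r]$ and $I_{S_2}\subset\Bbbk[Y_1,\dots,Y_t]$ are defined likewise from $A_1$, $A_2$. $Betti(S)$ is the set of $S$-degrees of the elements of a minimal ($S$-homogeneous, binomial) generating set of $I_S$ (independent of the choice).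 Definition (gluing). $S$ is the gluing of $S_1$ and $S_2$ if there is a nonzero binomial $X^{\gamma_X}-Y^{\gamma_Y}\in I_S$, with $\gamma_X\in\mathbb{N}^r$, $\gamma_Y\in\mathbb{N}^t$, such that $I_S=I_{S_1}+I_{S_2}+\langle X^{\gamma_X}-Y^{\gamma_Y}\rangle$. Such a binomial is called a glued binomial. A binomial of a semigroup ideal $I$ (a difference of two monomials lying in $I$) is indispensable if, up to a scalar multiple, it belongs to every system of binomial generators of $I$. For $m\in S$, $C_m$ is the set of monomials $X^\alpha Y^\beta$ of $S$-degree $m$. A monomial is pure if it involves only the indeterminates $X_1,\dots,X_r$ or only the indeterminates $Y_1,\dots,Y_t$. *)

theory Defs
  imports Complex_Main "HOL-Library.Poly_Mapping" "HOL-Library.Set_Algebras"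
begin

section \<open>Commutative semigroups with zero\<close>

inductive_set generated :: "'a::comm_monoid_add set \<Rightarrow> 'a set" for A where
  zero: "0 \<in> generated A"
| base: "x \<in> A \<Longrightarrow> x \<in> generated A"
| add: "x \<in> generated A \<Longrightarrow> y \<in> generated A \<Longrightarrow> x + y \<in> generated A"

definition minimally_generated_by :: "'a::comm_monoid_add set \<Rightarrow> 'a set \<Rightarrow> bool" where
  "minimally_generated_by S A \<longleftrightarrow> generated A = S \<and> (\<forall>B. B \<subset> A \<longrightarrow> generated B \<noteq> S)"

definition cancellative :: "'a::comm_monoid_add set \<Rightarrow> bool" where
  "cancellative S \<longleftrightarrow> (\<forall>m\<in>S. \<forall>n\<in>S. \<forall>n'\<in>S. m + n = m + n' \<longrightarrow> n = n')"

text \<open>The ambient type need not be a group, so \<open>S \<inter> (-S) = {0}\<close> is expressed by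
  saying that no nonzero element of \<open>S\<close> has an additive inverse in \<open>S\<close>.\<close>

definition reduced :: "'a::comm_monoid_add set \<Rightarrow> bool" where
  "reduced S \<longleftrightarrow> (\<forall>m\<in>S. (\<exists>n\<in>S. m + n = 0) \<longrightarrow> m = 0)"


section \<open>Polynomials and ideals\<close>

text \<open>Indeterminates are indexed by a type \<open>'v\<close>. An exponent vector (equivalently, a monomial)
  is an element of \<open>'v \<Rightarrow>\<^sub>0 nat\<close>, and the polynomial ring over \<open>'k\<close> is the monoid algebra
  \<open>('v \<Rightarrow>\<^sub>0 nat) \<Rightarrow>\<^sub>0 'k\<close>. For the ring with indeterminates \<open>X\<^sub>i\<close>, \<open>Y\<^sub>j\<close> the index type is a
  sum type, \<open>Inl i\<close> standing for \<open>X\<^sub>i\<close> and \<open>Inr j\<close> for \<open>Y\<^sub>j\<close>.\<close>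

type_synonym 'v expo = "'v \<Rightarrow>\<^sub>0 nat"
type_synonym ('v, 'k) mpoly = "('v \<Rightarrow>\<^sub>0 nat) \<Rightarrow>\<^sub>0 'k"

definition monom :: "'v expo \<Rightarrow> ('v, 'k::field) mpoly" where
  "monom \<alpha> = Poly_Mapping.single \<alpha> 1"

definition const :: "'k::field \<Rightarrow> ('v, 'k) mpoly" where
  "const c = Poly_Mapping.single 0 c"

global_interpretation ideal: module "(*) :: 'r::comm_ring_1 \<Rightarrow> 'r \<Rightarrow> 'r"
  by unfold_locales (simp_all add: algebra_simps)

abbreviation ideal_gen :: "'r::comm_ring_1 set \<Rightarrow> 'r set" where
  "ideal_gen \<equiv> ideal.span"

definition minimal_generating_set :: "'r::comm_ring_1 set \<Rightarrow> 'r set \<Rightarrow> bool" where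
  "minimal_generating_set B I \<longleftrightarrow> ideal_gen B = I \<and> (\<forall>B'. B' \<subset> B \<longrightarrow> ideal_gen B' \<noteq> I)"

text \<open>Push-forward along \<open>f\<close>. Applied to exponent vectors it renames indeterminates;
  \<open>push (push f)\<close> is the induced homomorphism of polynomial rings.\<close>

definition push :: "('x \<Rightarrow> 'y) \<Rightarrow> ('x \<Rightarrow>\<^sub>0 'c::comm_monoid_add) \<Rightarrow> ('y \<Rightarrow>\<^sub>0 'c)" where
  "push f p = (\<Sum>x\<in>Poly_Mapping.keys p. Poly_Mapping.single (f x) (Poly_Mapping.lookup p x))"


section \<open>Semigroup ideals\<close>

text \<open>Here \<open>c\<close> assigns to each indeterminate its degree in the semigroup. The inner sum is the
  \<open>\<alpha>\<^sub>v\<close>-fold multiple of \<open>c v\<close>.\<close>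

definition sdeg :: "('v::finite \<Rightarrow> 'a::comm_monoid_add) \<Rightarrow> 'v expo \<Rightarrow> 'a" where
  "sdeg c \<alpha> = (\<Sum>v\<in>UNIV. \<Sum>_<Poly_Mapping.lookup \<alpha> v. c v)"

definition homogeneous :: "('v::finite \<Rightarrow> 'a::comm_monoid_add) \<Rightarrow> 'a \<Rightarrow> ('v, 'k::field) mpoly \<Rightarrow> bool"
  where "homogeneous c m f \<longleftrightarrow> (\<forall>\<alpha>\<in>Poly_Mapping.keys f. sdeg c \<alpha> = m)"

definition semigroup_ideal :: "('v::finite \<Rightarrow> 'a::comm_monoid_add) \<Rightarrow> ('v, 'k::field) mpoly set" where
  "semigroup_ideal c = ideal_gen {monom \<alpha> - monom \<beta> | \<alpha> \<beta>. sdeg c \<alpha> = sdeg c \<beta>}"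

definition monomials_of_degree :: "('v::finite \<Rightarrow> 'a::comm_monoid_add) \<Rightarrow> 'a \<Rightarrow> 'v expo set" where
  "monomials_of_degree c m = {\<alpha>. sdeg c \<alpha> = m}"

definition is_binomial :: "('v, 'k::field) mpoly \<Rightarrow> bool" where
  "is_binomial f \<longleftrightarrow> (\<exists>\<alpha> \<beta>. f = monom \<alpha> - monom \<beta>)"

definition indispensable :: "('v, 'k::field) mpoly set \<Rightarrow> ('v, 'k) mpoly \<Rightarrow> bool" where
  "indispensable I f \<longleftrightarrow> is_binomial f \<and> f \<in> I \<and>
     (\<forall>B. (\<forall>g\<in>B. is_binomial g) \<and> ideal_gen B = I \<longrightarrow> (\<exists>e. e \<noteq> 0 \<and> const e * f \<in> B))"

text \<open>If \<open>f\<close> is indispensable then so is \<open>-f\<close>; hence a minimal generating set made of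
  indispensable binomials contains them only up to a scalar multiple.\<close>

definition minimally_generated_by_indispensables :: "('v, 'k::field) mpoly set \<Rightarrow> bool" where
  "minimally_generated_by_indispensables I \<longleftrightarrow>
     (\<exists>B. minimal_generating_set B I \<and> (\<forall>f\<in>B. indispensable I f) \<and>
          (\<forall>f. indispensable I f \<longrightarrow> (\<exists>e. e \<noteq> 0 \<and> const e * f \<in> B)))"

text \<open>The degrees occurring in a minimal homogeneous binomial generating set do not depend on
  the chosen set, so we collect them over all such sets. The first argument fixes the
  coefficient field.\<close>

definition betti :: "'k::field itself \<Rightarrow> ('v::finite \<Rightarrow> 'a::comm_monoid_add) \<Rightarrow> 'a set" where
  "betti _ c = {m. \<exists>(B :: ('v, 'k) mpoly set) f.
     minimal_generating_set B (semigroup_ideal c) \<and>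
     (\<forall>g\<in>B. is_binomial g \<and> (\<exists>n. homogeneous c n g)) \<and>
     f \<in> B \<and> f \<noteq> 0 \<and> homogeneous c m f}"


section \<open>Gluings\<close>

text \<open>For \<open>a\<close> and \<open>b\<close> the degrees of the \<open>X\<^sub>i\<close> and \<open>Y\<^sub>j\<close>, \<open>case_sum a b\<close> is the joint grading;
  the ideals of the two subsemigroups are extended to the joint polynomial ring.\<close>

definition glued_binomial ::
  "('r::finite \<Rightarrow> 'a::comm_monoid_add) \<Rightarrow> ('t::finite \<Rightarrow> 'a) \<Rightarrow> ('r + 't, 'k::field) mpoly \<Rightarrow> bool" where
  "glued_binomial a b f \<longleftrightarrow>
     (\<exists>\<gamma>X \<gamma>Y. f = monom (push Inl \<gamma>X) - monom (push Inr \<gamma>Y)) \<and>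
     f \<noteq> 0 \<and> f \<in> semigroup_ideal (case_sum a b) \<and>
     semigroup_ideal (case_sum a b) =
       ideal_gen (push (push Inl) ` semigroup_ideal a) +
       ideal_gen (push (push Inr) ` semigroup_ideal b) +
       ideal_gen {f}"

definition is_gluing ::
  "'k::field itself \<Rightarrow> ('r::finite \<Rightarrow> 'a::comm_monoid_add) \<Rightarrow> ('t::finite \<Rightarrow> 'a) \<Rightarrow> bool" where
  "is_gluing _ a b \<longleftrightarrow> (\<exists>f :: ('r + 't, 'k) mpoly. glued_binomial a b f)"

definition pure_monomial :: "('r + 't) expo \<Rightarrow> bool" where
  "pure_monomial \<alpha> \<longleftrightarrow> Poly_Mapping.keys \<alpha> \<subseteq> range Inl \<or> Poly_Mapping.keys \<alpha> \<subseteq> range Inr"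

end

theory Submission
  imports Defs
begin

text \<open>
  A binomial lies in an ideal generated by binomials if and only if its two exponent vectors are
  related by the congruence generated by the exponent pairs of the generators. This turns all
  conditions into statements about congruences: a pair \<open>(u, v)\<close> of degree \<open>m\<close> is indispensable
  iff \<open>u\<close> and \<open>v\<close> are the only monomials of degree \<open>m\<close> and have disjoint supports, and an ideal
  is minimally generated by its indispensable binomials iff the indispensable pairs generate the
  congruence of equal degree.

  Along any chain of generators of the gluing that starts at a pure \<open>X\<close>-monomial, the \<open>Y\<close>-part has
  degree \<open>n d\<close>, and replacing it by \<open>n \<gamma>\<^sub>X\<close> gives an \<open>X\<close>-monomial related to the starting point
  using generators of \<open>I\<^bsub>S\<^sub>1\<^esub>\<close> only. Hence generators of \<open>I\<^bsub>S\<^sub>1\<^esub>\<close> cannot be replaced by generators of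
  the other two kinds, so indispensable generators of both parts together with the glued binomial
  form a minimal generating set, and their degrees are Betti degrees. If an indispensable pair of
  \<open>I\<^bsub>S\<^sub>1\<^esub>\<close> shared its degree \<open>n d\<close> with a pure \<open>Y\<close>-monomial, the case \<open>n \<ge> 2\<close> would give
  the mixed monomial \<open>X\<^bsup>\<gamma>\<^sub>X\<^esup> Y\<^bsup>(n-1)\<gamma>\<^sub>Y\<^esup>\<close>, and \<open>n = 1\<close> contradicts the
  indispensability of the glued binomial.
\<close>

section \<open>Exponent vectors\<close>

text \<open>The key \<open>k\<close> may already occur in \<open>f\<close>. For additive maps such
  as \<open>push\<close> and \<open>sdeg\<close> this form reduces a claim to its case for
  \<open>single\<close>.\<close>

lemma poly_mapping_single_add_induct [case_names zero add]:
  fixes p :: "'b \<Rightarrow>\<^sub>0 'c::comm_monoid_add"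
  assumes "P 0" and "\<And>k e f. P f \<Longrightarrow> P (Poly_Mapping.single k e + f)"
  shows "P p"
proof (induction p rule: Poly_Mapping.update_induct)
  case const
  show ?case by (rule assms(1))
next
  case (update f k e)
  have "Poly_Mapping.update k e f = Poly_Mapping.single k e + f"
    using update(1)
    by (intro poly_mapping_eqI) (auto simp: lookup_update lookup_add lookup_single in_keys_iff)
  then show ?case using assms(2) update by simp
qed

lemma push_add: "push f (p + q) = push f p + push f q"
  unfolding push_def by (rule setsum_keys_plus_distrib) (simp_all add: single_add)

lemma push_zero [simp]: "push f 0 = 0"
  by (simp add: push_def)

lemma push_single [simp]: "push f (Poly_Mapping.single k e) = Poly_Mapping.single (f k) e"
  by (cases "e = 0") (simp_all add: push_def)

lemma map_key_push [simp]:
  assumes "inj f"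
  shows "Poly_Mapping.map_key f (push f p) = p"
proof (induction p rule: poly_mapping_single_add_induct)
  case zero
  show ?case using assms by simp
next
  case (add k e p)
  then show ?case using assms by (simp add: push_add map_key_plus)
qed

lemma map_key_push_disjoint:
  assumes "inj f" and "range f \<inter> range h = {}"
  shows "Poly_Mapping.map_key f (push h p) = 0"
proof (induction p rule: poly_mapping_single_add_induct)
  case zero
  show ?case using assms by simp
next
  case (add k e p)
  have "h k \<noteq> f x" for x using assms(2) by blast
  then have "Poly_Mapping.map_key f (Poly_Mapping.single (h k) e) = 0"
    using assms(1) by (intro poly_mapping_eqI) (auto simp: map_key.rep_eq lookup_single when_def)
  with add show ?case using assms by (simp add: push_add map_key_plus)
qed

lemma lookup_push:
  assumes "inj f"
  shows "Poly_Mapping.lookup (push f p) (f x) = Poly_Mapping.lookup p x"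
  using map_key.rep_eq[OF assms, of "push f p"] assms by (simp add: fun_eq_iff)

lemma keys_push: "Poly_Mapping.keys (push f p) \<subseteq> range f"
proof (induction p rule: poly_mapping_single_add_induct)
  case (add k e p)
  then show ?case
    using keys_add[of "Poly_Mapping.single (f k) e" "push f p"]
    by (auto simp: push_add split: if_splits)
qed simp

lemma push_eq_iff: "inj f \<Longrightarrow> push f p = push f q \<longleftrightarrow> p = q"
  by (metis map_key_push)

lemma sdeg_add:
  fixes c :: "'v::finite \<Rightarrow> 'a::comm_monoid_add"
  shows "sdeg c (\<alpha> + \<beta>) = sdeg c \<alpha> + sdeg c \<beta>"
proof -
  have *: "(\<Sum>_<m+n. x) = (\<Sum>_<m. x) + (\<Sum>_<n. x)" for m n :: nat and x :: 'a
    by (induction n) (simp_all add: add.assoc)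
  show ?thesis by (simp add: sdeg_def lookup_add * sum.distrib)
qed

lemma sdeg_zero [simp]: "sdeg c 0 = 0"
  by (simp add: sdeg_def)

lemma sdeg_single: "sdeg c (Poly_Mapping.single v n) = (\<Sum>_<n. c v)"
proof -
  have "sdeg c (Poly_Mapping.single v n) = (\<Sum>w\<in>UNIV. if w = v then (\<Sum>_<n. c v) else 0)"
    unfolding sdeg_def by (rule sum.cong) (auto simp: lookup_single when_def)
  then show ?thesis by simp
qed

lemma sdeg_push: "sdeg c (push f \<alpha>) = sdeg (c \<circ> f) \<alpha>"
  by (induction \<alpha> rule: poly_mapping_single_add_induct)
     (simp_all add: push_add sdeg_add sdeg_single)

section \<open>Congruences on exponent vectors\<close>

text \<open>The congruence generated by \<open>R\<close>, presented as chains of moves from a fixed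
  start \<open>x\<close>: a move replaces a factor \<open>u\<close> of the current monomial by
  \<open>v\<close>, or back. Inductions thus follow a chain from its start.\<close>

inductive_set congr :: "('m::comm_monoid_add \<times> 'm) set \<Rightarrow> ('m \<times> 'm) set" for R where
  refl: "(x, x) \<in> congr R"
| forward: "(x, u + w) \<in> congr R \<Longrightarrow> (u, v) \<in> R \<Longrightarrow> (x, v + w) \<in> congr R"
| backward: "(x, v + w) \<in> congr R \<Longrightarrow> (u, v) \<in> R \<Longrightarrow> (x, u + w) \<in> congr R"

lemma congr_trans: "(y, z) \<in> congr R \<Longrightarrow> (x, y) \<in> congr R \<Longrightarrow> (x, z) \<in> congr R"
  by (induction rule: congr.induct) (auto intro: congr.intros)

lemma congr_sym: "(x, y) \<in> congr R \<Longrightarrow> (y, x) \<in> congr R"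
  by (induction rule: congr.induct) (blast intro: congr.intros congr_trans)+

lemma congr_base: "(u, v) \<in> R \<Longrightarrow> (u, v) \<in> congr R"
  using congr.forward[of u u 0 R v] by (simp add: congr.refl)

lemma congr_superset: "R \<subseteq> congr R"
  using congr_base by auto

lemma congr_add: "(x, y) \<in> congr R \<Longrightarrow> (x + z, y + z) \<in> congr R"
proof (induction rule: congr.induct)
  case (forward x u w v)
  then show ?case using congr.forward[of "x + z" u "w + z" R v] by (simp add: ac_simps)
next
  case (backward x v w u)
  then show ?case using congr.backward[of "x + z" v "w + z" R u] by (simp add: ac_simps)
qed (rule congr.refl)

text \<open>Congruences are closed under translation, reversal and chaining, so an inclusion only
  has to be tested on generators.\<close>

lemma congr_subset:
  assumes "R \<subseteq> congr R'"
  shows "congr R \<subseteq> congr R'"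
proof -
  have "(x, y) \<in> congr R'" if "(x, y) \<in> congr R" for x y
    using that
  proof (induction rule: congr.induct)
    case (forward x u w v)
    then have "(u + w, v + w) \<in> congr R'" using assms congr_add by blast
    with forward show ?case using congr_trans by blast
  next
    case (backward x v w u)
    then have "(v + w, u + w) \<in> congr R'" using assms congr_add congr_sym by blast
    with backward show ?case using congr_trans by blast
  qed (rule congr.refl)
  then show ?thesis by auto
qed

lemma congr_mono: "R \<subseteq> R' \<Longrightarrow> congr R \<subseteq> congr R'"
  by (rule congr_subset) (auto intro: congr_base)

lemma congr_image_subset:
  assumes "\<And>x y. h (x + y) = h x + h y"
  shows "map_prod h h ` congr R \<subseteq> congr (map_prod h h ` R)"
proof -
  have "(h x, h y) \<in> congr (map_prod h h ` R)" if "(x, y) \<in> congr R" for x y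
    using that
  proof (induction rule: congr.induct)
    case (forward x u w v)
    then have "(h u, h v) \<in> map_prod h h ` R" by force
    with forward(3) show ?case
      using congr.forward[of "h x" "h u" "h w" _ "h v"] by (simp add: assms)
  next
    case (backward x v w u)
    then have "(h u, h v) \<in> map_prod h h ` R" by force
    with backward(3) show ?case
      using congr.backward[of "h x" "h v" "h w" _ "h u"] by (simp add: assms)
  qed (rule congr.refl)
  then show ?thesis by auto
qed

definition sdeg_kernel :: "('v::finite \<Rightarrow> 'a::comm_monoid_add) \<Rightarrow> ('v expo \<times> 'v expo) set" where
  "sdeg_kernel c = {(\<alpha>, \<beta>). sdeg c \<alpha> = sdeg c \<beta>}"

lemma congr_subset_kernel:
  assumes "R \<subseteq> sdeg_kernel c"
  shows "congr R \<subseteq> sdeg_kernel c"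
proof -
  have "sdeg c x = sdeg c y" if "(x, y) \<in> congr R" for x y
    using that assms by (induction rule: congr.induct) (force simp: sdeg_kernel_def sdeg_add)+
  then show ?thesis by (auto simp: sdeg_kernel_def)
qed

lemma subset_kernel_if_congr_eq: "congr R = sdeg_kernel c \<Longrightarrow> R \<subseteq> sdeg_kernel c"
  using congr_base by auto

section \<open>Binomial ideals\<close>

definition binom_of :: "'v expo \<times> 'v expo \<Rightarrow> ('v, 'k::field) mpoly" where
  "binom_of p = monom (fst p) - monom (snd p)"

lemma is_binomial_iff: "is_binomial f \<longleftrightarrow> f \<in> range binom_of"
  by (simp add: is_binomial_def binom_of_def image_def)

lemma monom_mult: "monom \<alpha> * monom \<beta> = monom (\<alpha> + \<beta>)"
  by (simp add: monom_def mult_single)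

definition coeff_sum :: "'v expo set \<Rightarrow> ('v, 'k::field) mpoly \<Rightarrow> 'k" where
  "coeff_sum C f = (\<Sum>\<alpha>\<in>Poly_Mapping.keys f. if \<alpha> \<in> C then Poly_Mapping.lookup f \<alpha> else 0)"

lemma coeff_sum_add: "coeff_sum C (f + g) = coeff_sum C f + coeff_sum C g"
  unfolding coeff_sum_def
  by (rule setsum_keys_plus_distrib[of "\<lambda>\<alpha> e. if \<alpha> \<in> C then e else 0"]) auto

lemma coeff_sum_single: "coeff_sum C (Poly_Mapping.single \<alpha> e) = (if \<alpha> \<in> C then e else 0)"
  by (cases "e = 0") (simp_all add: coeff_sum_def)

text \<open>These functionals separate congruence classes: adding up the coefficients over one class
  kills every multiple of a generator.\<close>

lemma coeff_sum_congr_class: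
  assumes "f \<in> ideal_gen (binom_of ` R)"
  shows "coeff_sum {y. (x, y) \<in> congr R} f = 0" (is "coeff_sum ?C f = 0")
  using assms
proof (induction rule: ideal.span_induct_alt)
  case base
  show ?case by (simp add: coeff_sum_def)
next
  case (step p b f)
  obtain u v where uv: "(u, v) \<in> R" "b = binom_of (u, v)" using step(1) by auto
  have "coeff_sum ?C (p * b) = 0"
  proof (induction p rule: poly_mapping_single_add_induct)
    case zero
    show ?case by (simp add: coeff_sum_def)
  next
    case (add k e p)
    \<comment> \<open>The class is closed under moves in both directions, so the coefficients
      \<open>e\<close> and \<open>- e\<close> are counted together or not at all.\<close>
    have "k + u \<in> ?C \<longleftrightarrow> k + v \<in> ?C"
      using uv(1) congr.forward[of x u k R v] congr.backward[of x v k R u]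
      by (auto simp: add.commute)
    moreover have "Poly_Mapping.single k e * b
        = Poly_Mapping.single (k + u) e + Poly_Mapping.single (k + v) (- e)"
      by (simp add: uv binom_of_def monom_def right_diff_distrib mult_single single_uminus)
    ultimately show ?case
      using add by (simp add: distrib_right coeff_sum_add coeff_sum_single)
  qed
  then show ?case using step by (simp add: coeff_sum_add)
qed

text \<open>Dictionary between ideals and congruences. The coefficient sum over the class of
  \<open>\<alpha>\<close> vanishes on the ideal, but is 1 on the binomial if \<open>\<beta>\<close>
  lies outside that class; this works in every characteristic. Conversely, the moves of a chain
  telescope to a combination of generators.\<close>

lemma binom_of_mem_ideal_iff:
  "(binom_of (\<alpha>, \<beta>) :: ('v, 'k::field) mpoly) \<in> ideal_gen (binom_of ` R) \<longleftrightarrow> (\<alpha>, \<beta>) \<in> congr R"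
proof
  assume *: "(binom_of (\<alpha>, \<beta>) :: ('v, 'k) mpoly) \<in> ideal_gen (binom_of ` R)"
  have "binom_of (\<alpha>, \<beta>) = Poly_Mapping.single \<alpha> (1::'k) + Poly_Mapping.single \<beta> (- 1)"
    by (simp add: binom_of_def monom_def single_uminus)
  then have "coeff_sum {y. (\<alpha>, y) \<in> congr R} (binom_of (\<alpha>, \<beta>) :: ('v, 'k) mpoly)
      = 1 - (if (\<alpha>, \<beta>) \<in> congr R then 1 else 0)"
    by (simp add: coeff_sum_add coeff_sum_single congr.refl)
  with coeff_sum_congr_class[OF *] show "(\<alpha>, \<beta>) \<in> congr R"
    by (simp split: if_splits)
next
  let ?J = "ideal_gen (binom_of ` R) :: ('v, 'k) mpoly set"
  assume "(\<alpha>, \<beta>) \<in> congr R"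
  then show "binom_of (\<alpha>, \<beta>) \<in> ?J"
  proof (induction rule: congr.induct)
    case (refl x)
    show ?case by (simp add: binom_of_def ideal.span_zero)
  next
    case (forward x u w v)
    then have "monom w * binom_of (u, v) \<in> ?J"
      by (intro ideal.span_scale ideal.span_base) (rule imageI)
    from ideal.span_add[OF forward.IH this] show ?case
      by (simp add: binom_of_def right_diff_distrib monom_mult ac_simps)
  next
    case (backward x v w u)
    then have "monom w * binom_of (u, v) \<in> ?J"
      by (intro ideal.span_scale ideal.span_base) (rule imageI)
    from ideal.span_diff[OF backward.IH this] show ?case
      by (simp add: binom_of_def right_diff_distrib monom_mult ac_simps)
  qed
qed

lemma semigroup_ideal_eq:
  "(semigroup_ideal c :: ('v::finite, 'k::field) mpoly set) = ideal_gen (binom_of ` sdeg_kernel c)"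
proof -
  have "{monom \<alpha> - monom \<beta> | \<alpha> \<beta>. sdeg c \<alpha> = sdeg c \<beta>}
      = (binom_of ` sdeg_kernel c :: ('v, 'k) mpoly set)"
    by (force simp: sdeg_kernel_def binom_of_def image_def)
  then show ?thesis by (simp add: semigroup_ideal_def)
qed

text \<open>Equality of degrees is itself a congruence, so passing to the generated congruence adds
  no pairs.\<close>

lemma binom_of_mem_semigroup_ideal_iff:
  "binom_of p \<in> semigroup_ideal c \<longleftrightarrow> p \<in> sdeg_kernel c"
proof -
  have "congr (sdeg_kernel c) = sdeg_kernel c"
    using congr_subset_kernel[of "sdeg_kernel c" c] congr_base by fast
  then show ?thesis
    using binom_of_mem_ideal_iff[of "fst p" "snd p" "sdeg_kernel c"] by (simp add: semigroup_ideal_eq)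
qed

lemma ideal_gen_binom_of_subset_iff:
  "ideal_gen (binom_of ` R) \<subseteq> (ideal_gen (binom_of ` R') :: ('v, 'k::field) mpoly set)
     \<longleftrightarrow> R \<subseteq> congr R'"
proof
  assume "ideal_gen (binom_of ` R) \<subseteq> (ideal_gen (binom_of ` R') :: ('v, 'k) mpoly set)"
  then have "(binom_of p :: ('v, 'k) mpoly) \<in> ideal_gen (binom_of ` R')" if "p \<in> R" for p
    using that by (blast intro: ideal.span_base)
  then show "R \<subseteq> congr R'" by (metis binom_of_mem_ideal_iff subrelI)
next
  assume "R \<subseteq> congr R'"
  then have "binom_of ` R \<subseteq> (ideal_gen (binom_of ` R') :: ('v, 'k) mpoly set)"
    by (force simp: binom_of_mem_ideal_iff)
  then show "ideal_gen (binom_of ` R) \<subseteq> (ideal_gen (binom_of ` R') :: ('v, 'k) mpoly set)"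
    by (simp add: ideal.span_minimal)
qed

lemma ideal_gen_binom_of_eq_iff:
  "ideal_gen (binom_of ` R) = (semigroup_ideal c :: ('v::finite, 'k::field) mpoly set)
     \<longleftrightarrow> congr R = sdeg_kernel c"
proof -
  have "congr (sdeg_kernel c) = sdeg_kernel c"
    using congr_subset_kernel[of "sdeg_kernel c" c] congr_base by fast
  moreover have "R \<subseteq> sdeg_kernel c \<longleftrightarrow> congr R \<subseteq> sdeg_kernel c"
    using congr_subset_kernel congr_base by (metis subrelI subsetD)
  ultimately show ?thesis
    by (auto simp: semigroup_ideal_eq set_eq_subset ideal_gen_binom_of_subset_iff)
qed

section \<open>Recovering exponent pairs from binomials\<close>

lemma binom_set_eq_image:
  assumes "\<forall>f\<in>B. is_binomial f"
  shows "B = binom_of ` {p. binom_of p \<in> B}"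
  using assms by (auto simp: is_binomial_iff image_iff)

lemma lookup_binom_of:
  "Poly_Mapping.lookup (binom_of (u, v) :: ('v, 'k::field) mpoly) x
     = (if x = u then 1 else 0) - (if x = v then 1 else 0)"
  by (simp add: binom_of_def monom_def lookup_minus lookup_single when_def)

lemma lookup_const_mult:
  "Poly_Mapping.lookup (const e * f) x = e * Poly_Mapping.lookup f x"
proof (induction f rule: poly_mapping_single_add_induct)
  case (add k e' f)
  then show ?case
    by (simp add: const_def distrib_left mult_single lookup_add lookup_single when_def)
qed simp

text \<open>The coefficients at \<open>u\<close> and \<open>v\<close> are \<open>e\<close> and
  \<open>- e\<close>, both nonzero, so these two exponents must be the two exponents on the right.
  Their order stays open, as the scalar may be -1.\<close>

lemma const_mult_binom_of_eqD:
  assumes "const e * binom_of (u, v) = (binom_of (u', v') :: ('v, 'k::field) mpoly)"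
    and "u \<noteq> v" and "e \<noteq> 0"
  shows "(u', v') = (u, v) \<or> (u', v') = (v, u)"
proof -
  have *: "e * ((if x = u then 1 else 0) - (if x = v then 1 else 0))
      = (if x = u' then 1 else 0) - (if x = v' then 1 else 0)" for x
    using assms(1) by (metis lookup_const_mult lookup_binom_of)
  show ?thesis using *[of u] *[of v] assms(2,3) by (auto split: if_splits)
qed

lemma const_one_mult [simp]: "const 1 * f = f"
  by (simp add: const_def)

lemma const_minus_one_mult: "const (- 1) * binom_of (u, v) = binom_of (v, u)"
  by (simp add: binom_of_def const_def monom_def right_diff_distrib mult_single single_uminus)

lemma binom_of_eq_zero_iff: "binom_of (u, v) = (0 :: ('v, 'k::field) mpoly) \<longleftrightarrow> u = v"
proof
  assume "binom_of (u, v) = (0 :: ('v, 'k) mpoly)"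
  then have "Poly_Mapping.lookup (binom_of (u, v) :: ('v, 'k) mpoly) u = 0" by simp
  then show "u = v" by (simp add: lookup_binom_of split: if_splits)
qed (simp add: binom_of_def)

lemma homogeneous_binom_of_iff:
  assumes "u \<noteq> v"
  shows "homogeneous c m (binom_of (u, v) :: ('v::finite, 'k::field) mpoly)
    \<longleftrightarrow> sdeg c u = m \<and> sdeg c v = m"
proof -
  have "Poly_Mapping.keys (binom_of (u, v) :: ('v, 'k) mpoly) = {u, v}"
    using assms by (auto simp: in_keys_iff lookup_binom_of split: if_splits)
  then show ?thesis by (simp add: homogeneous_def)
qed

section \<open>Indispensable binomials\<close>

lemma indispensableE:
  assumes "indispensable I f" and "ideal_gen (binom_of ` R) = I"
  obtains e where "e \<noteq> 0" and "const e * f \<in> binom_of ` R"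
proof -
  have "\<forall>g\<in>binom_of ` R. is_binomial g" by (simp add: is_binomial_iff)
  then show ?thesis using assms that unfolding indispensable_def by blast
qed

text \<open>Cancellation restricted to degrees of monomials, so that later arguments need not
  mention the semigroup.\<close>

definition cancel_grading :: "('v::finite \<Rightarrow> 'a::comm_monoid_add) \<Rightarrow> bool" where
  "cancel_grading c \<longleftrightarrow> (\<forall>\<alpha> \<beta> \<gamma>.
     sdeg c \<alpha> + sdeg c \<beta> = sdeg c \<alpha> + sdeg c \<gamma> \<longrightarrow> sdeg c \<beta> = sdeg c \<gamma>)"

text \<open>A description by degrees and supports alone, independent of the coefficient field. Both
  orientations of a pair are included.\<close>

definition indispensable_pairs ::
  "('v::finite \<Rightarrow> 'a::comm_monoid_add) \<Rightarrow> ('v expo \<times> 'v expo) set" where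
  "indispensable_pairs c = {(u, v). u \<noteq> v \<and> monomials_of_degree c (sdeg c u) = {u, v} \<and>
     Poly_Mapping.keys u \<inter> Poly_Mapping.keys v = {}}"

lemma indispensable_pairs_iff:
  "(u, v) \<in> indispensable_pairs c \<longleftrightarrow> u \<noteq> v \<and> (\<forall>z. sdeg c z = sdeg c u \<longleftrightarrow> z = u \<or> z = v) \<and>
     Poly_Mapping.keys u \<inter> Poly_Mapping.keys v = {}"
  by (simp add: indispensable_pairs_def monomials_of_degree_def set_eq_iff)

lemma indispensable_pairs_sym: "(u, v) \<in> indispensable_pairs c \<Longrightarrow> (v, u) \<in> indispensable_pairs c"
  by (metis indispensable_pairs_iff Int_commute)

lemma indispensable_pairs_subset_kernel: "indispensable_pairs c \<subseteq> sdeg_kernel c"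
  by (clarsimp simp: indispensable_pairs_iff sdeg_kernel_def) metis

text \<open>A chain from \<open>u\<close> to \<open>v\<close> stays within their degree and so
  visits only these two monomials. A move between them has no common factor because the supports are
  disjoint, hence it is itself a generator.\<close>

lemma indispensable_pair_mem:
  assumes uv: "(u, v) \<in> indispensable_pairs c" and R: "congr R = sdeg_kernel c"
  shows "(u, v) \<in> R \<or> (v, u) \<in> R"
proof (rule ccontr)
  assume not: "\<not> ?thesis"
  have sub: "R \<subseteq> sdeg_kernel c" using R by (rule subset_kernel_if_congr_eq)
  have uv': "u \<noteq> v" "Poly_Mapping.keys u \<inter> Poly_Mapping.keys v = {}"
    and deg: "\<And>z. sdeg c z = sdeg c u \<longleftrightarrow> z = u \<or> z = v"
    using uv by (auto simp: indispensable_pairs_iff)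
  have zero: "w = 0" if "u = p + w" "v = q + w" for p q w
  proof (rule poly_mapping_eqI)
    fix x
    have "Poly_Mapping.lookup u x = 0 \<or> Poly_Mapping.lookup v x = 0"
      using uv'(2) by (auto simp: in_keys_iff)
    then show "Poly_Mapping.lookup w x = Poly_Mapping.lookup 0 x"
      using that by (auto simp: lookup_add)
  qed
  \<comment> \<open>If neither orientation is in \<open>R\<close>, a chain starting at
    \<open>u\<close> never leaves \<open>u\<close>.\<close>
  have "y = u" if "(x, y) \<in> congr R" "x = u" for x y
    using that
  proof (induction rule: congr.induct)
    case (forward x p w q)
    then have "sdeg c (q + w) = sdeg c u" using sub by (force simp: sdeg_kernel_def sdeg_add)
    with deg have "q + w = u \<or> q + w = v" by blast
    then show ?case using forward zero[of p w q] not by auto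
  next
    case (backward x q w p)
    then have "sdeg c (p + w) = sdeg c u" using sub by (force simp: sdeg_kernel_def sdeg_add)
    with deg have "p + w = u \<or> p + w = v" by blast
    then show ?case using backward zero[of q w p] not by auto
  qed simp
  moreover have "(u, v) \<in> congr R"
    using uv R indispensable_pairs_subset_kernel by blast
  ultimately show False using uv'(1) by blast
qed

text \<open>A pair fails to be indispensable for one of two reasons, and each lets it be recovered:
  a third monomial of the same degree serves as an intermediate stop, or a common indeterminate can
  be divided out.\<close>

lemma kernel_without_pair:
  assumes c: "cancel_grading c" and uv: "(u, v) \<in> sdeg_kernel c" "u \<noteq> v"
    and not: "(u, v) \<notin> indispensable_pairs c"
  shows "congr (sdeg_kernel c - {(u, v), (v, u)}) = sdeg_kernel c" (is "congr ?R = _")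
proof
  show "congr ?R \<subseteq> sdeg_kernel c" by (rule congr_subset_kernel) auto
  have uv_mem: "(u, v) \<in> congr ?R"
  proof (cases "monomials_of_degree c (sdeg c u) = {u, v}")
    case False
    moreover have "{u, v} \<subseteq> monomials_of_degree c (sdeg c u)"
      using uv(1) by (auto simp: monomials_of_degree_def sdeg_kernel_def)
    ultimately obtain w where w: "sdeg c w = sdeg c u" "w \<noteq> u" "w \<noteq> v"
      by (auto simp: monomials_of_degree_def)
    then have "(u, w) \<in> ?R" "(w, v) \<in> ?R" using uv by (auto simp: sdeg_kernel_def)
    then show ?thesis by (meson congr_base congr_trans)
  next
    case True
    then obtain x where x: "Poly_Mapping.lookup u x \<noteq> 0" "Poly_Mapping.lookup v x \<noteq> 0"
      using not uv(2) by (auto simp: indispensable_pairs_def in_keys_iff)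
    let ?s = "Poly_Mapping.single x (1::nat)"
    have eq: "y = (y - ?s) + ?s" if "Poly_Mapping.lookup y x \<noteq> 0" for y
      using that by (intro poly_mapping_eqI) (auto simp: lookup_add lookup_minus lookup_single when_def)
    define u' v' where "u' = u - ?s" and "v' = v - ?s"
    have u: "u = u' + ?s" and v: "v = v' + ?s" using eq x by (simp_all add: u'_def v'_def)
    have "?s + q \<noteq> q" for q
      by (metis add_cancel_left_left lookup_single_eq lookup_zero one_neq_zero)
    then have neq: "u' \<noteq> u" "v' \<noteq> v" using u v by (metis add.commute)+
    \<comment> \<open>Cancellativity keeps the degrees equal after division by the common
      indeterminate.\<close>
    have "sdeg c ?s + sdeg c u' = sdeg c ?s + sdeg c v'"
      using uv(1) u v
      by (metis (mono_tags, lifting) add.commute case_prodD mem_Collect_eq sdeg_add sdeg_kernel_def)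
    then have "sdeg c u' = sdeg c v'" using c by (auto simp: cancel_grading_def)
    \<comment> \<open>The quotient pair must survive the removal; being the reversed pair would make
      \<open>u\<close> equal to itself times a square of an indeterminate.\<close>
    moreover have "(u', v') \<noteq> (v, u)"
    proof
      assume "(u', v') = (v, u)"
      then have "u = u + (?s + ?s)" using u v by (metis Pair_inject add.assoc)
      then have "Poly_Mapping.lookup u x = Poly_Mapping.lookup (u + (?s + ?s)) x" by simp
      then show False by (simp add: lookup_add)
    qed
    ultimately have "(u', v') \<in> ?R" using neq by (auto simp: sdeg_kernel_def)
    then show ?thesis using u v congr_add congr_base by metis
  qed
  then show "sdeg_kernel c \<subseteq> congr ?R"
    using congr_sym[OF uv_mem] congr_base[of _ _ ?R] by auto
qed

text \<open>A binomial whose pair is not indispensable is missing, up to scalars, from the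
  generating set that \<open>kernel_without_pair\<close> provides. For the converse,
  \<open>indispensable_pair_mem\<close> yields the scalar 1 or -1.\<close>

lemma indispensable_iff:
  assumes c: "cancel_grading c"
  shows "indispensable (semigroup_ideal c) (f :: ('v::finite, 'k::field) mpoly)
    \<longleftrightarrow> f \<in> binom_of ` indispensable_pairs c"
proof
  assume f: "indispensable (semigroup_ideal c) f"
  then obtain u v where uv: "f = binom_of (u, v)"
    by (auto simp: indispensable_def is_binomial_iff)
  then have ker: "(u, v) \<in> sdeg_kernel c"
    using f by (simp add: indispensable_def binom_of_mem_semigroup_ideal_iff)
  \<comment> \<open>The zero binomial also counts as a binomial; it is ruled out because the pairs
    off the diagonal already generate.\<close>
  have neq: "u \<noteq> v"
  proof
    assume eq: "u = v"
    let ?B = "binom_of ` {p \<in> sdeg_kernel c. fst p \<noteq> snd p} :: ('v, 'k) mpoly set"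
    have "sdeg_kernel c \<subseteq> congr {p \<in> sdeg_kernel c. fst p \<noteq> snd p}"
    proof (rule subrelI)
      fix p q assume "(p, q) \<in> sdeg_kernel c"
      then show "(p, q) \<in> congr {p \<in> sdeg_kernel c. fst p \<noteq> snd p}"
        by (cases "p = q") (auto intro: congr.refl congr_base)
    qed
    then have "congr {p \<in> sdeg_kernel c. fst p \<noteq> snd p} = sdeg_kernel c"
      using congr_subset_kernel[of "{p \<in> sdeg_kernel c. fst p \<noteq> snd p}" c] by auto
    then have "ideal_gen ?B = semigroup_ideal c" by (simp add: ideal_gen_binom_of_eq_iff)
    with f obtain e where "const e * f \<in> ?B" by (rule indispensableE) blast
    moreover have "const e * f = 0" using eq uv by (simp add: binom_of_def)
    ultimately show False using binom_of_eq_zero_iff by fastforce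
  qed
  have "(u, v) \<in> indispensable_pairs c"
  proof (rule ccontr)
    assume "(u, v) \<notin> indispensable_pairs c"
    let ?R = "sdeg_kernel c - {(u, v), (v, u)}"
    have "ideal_gen (binom_of ` ?R) = (semigroup_ideal c :: ('v, 'k) mpoly set)"
      using kernel_without_pair[OF c ker neq] \<open>(u, v) \<notin> _\<close> by (simp add: ideal_gen_binom_of_eq_iff)
    with f obtain e where "e \<noteq> 0" "const e * f \<in> binom_of ` ?R" by (rule indispensableE)
    then obtain p q where "(p, q) \<in> ?R" "const e * binom_of (u, v) = (binom_of (p, q) :: ('v, 'k) mpoly)"
      using uv by auto
    then show False using const_mult_binom_of_eqD[of e u v p q] neq \<open>e \<noteq> 0\<close> by auto
  qed
  then show "f \<in> binom_of ` indispensable_pairs c" using uv by blast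
next
  assume "f \<in> binom_of ` indispensable_pairs c"
  then obtain u v where uv: "(u, v) \<in> indispensable_pairs c" "f = binom_of (u, v)" by auto
  have "\<exists>e. e \<noteq> 0 \<and> const e * f \<in> B"
    if B: "\<forall>g\<in>B. is_binomial g" "ideal_gen B = semigroup_ideal c" for B
  proof -
    have "congr {p. binom_of p \<in> B} = sdeg_kernel c"
      using B(2) binom_set_eq_image[OF B(1)] by (metis ideal_gen_binom_of_eq_iff)
    from indispensable_pair_mem[OF uv(1) this] have "binom_of (u, v) \<in> B \<or> binom_of (v, u) \<in> B"
      by simp
    then show ?thesis
    proof
      assume "binom_of (u, v) \<in> B"
      then show ?thesis using uv(2) by (intro exI[of _ 1]) simp
    next
      assume "binom_of (v, u) \<in> B"
      then show ?thesis using uv(2) by (intro exI[of _ "- 1"]) (simp add: const_minus_one_mult)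
    qed
  qed
  then show "indispensable (semigroup_ideal c) f"
    using uv indispensable_pairs_subset_kernel
    by (auto simp: indispensable_def is_binomial_iff binom_of_mem_semigroup_ideal_iff)
qed

section \<open>Minimal generating sets and Betti degrees\<close>

lemma minimal_generating_set_binom_of:
  assumes "congr R = sdeg_kernel c" and "\<And>p. p \<in> R \<Longrightarrow> congr (R - {p}) \<noteq> sdeg_kernel c"
  shows "minimal_generating_set (binom_of ` R) (semigroup_ideal c :: ('v::finite, 'k::field) mpoly set)"
  unfolding minimal_generating_set_def
proof (intro conjI allI impI notI)
  show gen: "ideal_gen (binom_of ` R) = (semigroup_ideal c :: ('v, 'k) mpoly set)"
    using assms(1) by (simp add: ideal_gen_binom_of_eq_iff)
  fix B assume B: "B \<subset> (binom_of ` R :: ('v, 'k) mpoly set)" "ideal_gen B = semigroup_ideal c"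
  \<comment> \<open>A proper subset misses the binomial of some single pair, so irredundancy under
    removal of one pair suffices.\<close>
  then obtain p where p: "p \<in> R" "(binom_of p :: ('v, 'k) mpoly) \<notin> B" by blast
  then have "B \<subseteq> binom_of ` (R - {p})" using B(1) by blast
  then have "ideal_gen (binom_of ` (R - {p})) = (semigroup_ideal c :: ('v, 'k) mpoly set)"
    using B(2) gen ideal.span_mono[of B "binom_of ` (R - {p})"]
      ideal.span_mono[of "binom_of ` (R - {p})" "binom_of ` R :: ('v, 'k) mpoly set"] by blast
  then show False using assms(2) p(1) by (simp add: ideal_gen_binom_of_eq_iff)
qed

text \<open>The degree of an indispensable pair determines it up to order, so an arbitrary choice of an
  exponent vector in each degree selects exactly one of the two orientations.\<close>

definition oriented_pairs ::
  "('v::finite \<Rightarrow> 'a::comm_monoid_add) \<Rightarrow> ('v expo \<times> 'v expo) set" where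
  "oriented_pairs c = {p \<in> indispensable_pairs c. (SOME w. sdeg c w = sdeg c (fst p)) = fst p}"

text \<open>The exponent vector chosen in the degree of \<open>u\<close> can only be
  \<open>u\<close> or \<open>v\<close>, and its place decides the orientation.\<close>

lemma oriented_pairs_cases:
  assumes "(u, v) \<in> indispensable_pairs c"
  shows "(u, v) \<in> oriented_pairs c \<or> (v, u) \<in> oriented_pairs c"
proof -
  have deg: "sdeg c z = sdeg c u \<longleftrightarrow> z = u \<or> z = v" for z
    using assms by (auto simp: indispensable_pairs_iff)
  have "sdeg c (SOME w. sdeg c w = sdeg c u) = sdeg c u" by (rule someI) (rule HOL.refl)
  then have "(SOME w. sdeg c w = sdeg c u) = u \<or> (SOME w. sdeg c w = sdeg c u) = v"
    using deg by blast
  moreover have "sdeg c v = sdeg c u" using deg by blast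
  ultimately show ?thesis
    using assms indispensable_pairs_sym[OF assms] by (auto simp: oriented_pairs_def)
qed

lemma oriented_pairs_antisym:
  assumes "(u, v) \<in> oriented_pairs c" and "(v, u) \<in> oriented_pairs c"
  shows False
proof -
  have "sdeg c v = sdeg c u" and "u \<noteq> v"
    using assms(1) by (auto simp: oriented_pairs_def indispensable_pairs_iff)
  then show False using assms by (auto simp: oriented_pairs_def)
qed

lemma oriented_pairs_subset: "oriented_pairs c \<subseteq> indispensable_pairs c"
  by (auto simp: oriented_pairs_def)

lemma congr_oriented_pairs: "congr (oriented_pairs c) = congr (indispensable_pairs c)"
proof
  show "congr (oriented_pairs c) \<subseteq> congr (indispensable_pairs c)"
    by (intro congr_mono oriented_pairs_subset)
  show "congr (indispensable_pairs c) \<subseteq> congr (oriented_pairs c)"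
    by (intro congr_subset subrelI) (metis oriented_pairs_cases congr_base congr_sym)
qed

text \<open>Every generating set contains some orientation of each indispensable pair; once
  \<open>p\<close> is removed only its reverse could serve, and that was not selected.\<close>

lemma oriented_pairs_irredundant:
  assumes "p \<in> oriented_pairs c"
  shows "congr (oriented_pairs c - {p}) \<noteq> sdeg_kernel c"
proof
  assume *: "congr (oriented_pairs c - {p}) = sdeg_kernel c"
  obtain u v where p: "p = (u, v)" by fastforce
  have "(v, u) \<in> oriented_pairs c"
    using indispensable_pair_mem[OF _ *, of u v] assms p by (auto simp: oriented_pairs_def)
  then show False using oriented_pairs_antisym assms p by blast
qed

text \<open>One orientation per pair gives an irredundant generating set, and any indispensable
  binomial occurs in it up to a scalar because it does so in every binomial generating set.\<close>

lemma minimally_generated_by_indispensables_iff: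
  assumes c: "cancel_grading c"
  shows "minimally_generated_by_indispensables (semigroup_ideal c :: ('v::finite, 'k::field) mpoly set)
    \<longleftrightarrow> congr (indispensable_pairs c) = sdeg_kernel c"
proof
  assume "minimally_generated_by_indispensables (semigroup_ideal c :: ('v, 'k) mpoly set)"
  then obtain B where B: "ideal_gen B = (semigroup_ideal c :: ('v, 'k) mpoly set)"
      "B \<subseteq> binom_of ` indispensable_pairs c"
    unfolding minimally_generated_by_indispensables_def minimal_generating_set_def
      indispensable_iff[OF c] by (elim exE conjE) (rule that, auto)
  define R where "R = {p \<in> indispensable_pairs c. (binom_of p :: ('v, 'k) mpoly) \<in> B}"
  have "B = binom_of ` R" using B(2) by (auto simp: R_def subset_iff image_iff)
  with B(1) have "congr R = sdeg_kernel c" by (simp add: ideal_gen_binom_of_eq_iff)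
  moreover have "congr R \<subseteq> congr (indispensable_pairs c)" by (rule congr_mono) (auto simp: R_def)
  ultimately show "congr (indispensable_pairs c) = sdeg_kernel c"
    using congr_subset_kernel[OF indispensable_pairs_subset_kernel] by blast
next
  assume *: "congr (indispensable_pairs c) = sdeg_kernel c"
  let ?B = "binom_of ` oriented_pairs c :: ('v, 'k) mpoly set"
  have "minimal_generating_set ?B (semigroup_ideal c)"
    by (rule minimal_generating_set_binom_of)
       (use * oriented_pairs_irredundant in \<open>simp_all add: congr_oriented_pairs\<close>)
  moreover have "\<forall>f\<in>?B. indispensable (semigroup_ideal c) f"
    using oriented_pairs_subset by (auto simp: indispensable_iff[OF c])
  moreover have "\<exists>e. e \<noteq> 0 \<and> const e * f \<in> ?B" if f: "indispensable (semigroup_ideal c) f" for f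
  proof -
    have "ideal_gen ?B = semigroup_ideal c"
      using * by (simp add: ideal_gen_binom_of_eq_iff congr_oriented_pairs)
    with f obtain e where "e \<noteq> 0" "const e * f \<in> ?B" by (rule indispensableE)
    then show ?thesis by blast
  qed
  ultimately show "minimally_generated_by_indispensables (semigroup_ideal c :: ('v, 'k) mpoly set)"
    unfolding minimally_generated_by_indispensables_def by blast
qed

text \<open>The generators coming from indispensable pairs already suffice, so a minimal binomial
  generating set contains no others.\<close>

lemma betti_degree_indispensable:
  fixes c :: "'v::finite \<Rightarrow> 'a::comm_monoid_add"
  assumes gen: "congr (indispensable_pairs c) = sdeg_kernel c"
    and m: "m \<in> betti TYPE('k::field) c"
  obtains u v where "(u, v) \<in> indispensable_pairs c" and "sdeg c u = m"
proof -
  obtain B :: "('v, 'k) mpoly set" and f :: "('v, 'k) mpoly"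
    where B: "minimal_generating_set B (semigroup_ideal c)"
      "\<forall>g\<in>B. is_binomial g" and f: "f \<in> B" "f \<noteq> 0" "homogeneous c m f"
    using m unfolding betti_def by blast
  define E where "E = {p. (binom_of p :: ('v, 'k) mpoly) \<in> B}"
  have "B = binom_of ` E" unfolding E_def by (rule binom_set_eq_image[OF B(2)])
  with B(1) have "congr E = sdeg_kernel c"
    by (simp add: ideal_gen_binom_of_eq_iff minimal_generating_set_def)
  then have ind: "(u, v) \<in> E \<or> (v, u) \<in> E" if "(u, v) \<in> indispensable_pairs c" for u v
    using indispensable_pair_mem that by blast
  let ?F = "E \<inter> indispensable_pairs c"
  have "indispensable_pairs c \<subseteq> congr ?F"
  proof (rule subrelI)
    fix u v assume uv: "(u, v) \<in> indispensable_pairs c"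
    then have "(u, v) \<in> ?F \<or> (v, u) \<in> ?F"
      using ind[OF uv] indispensable_pairs_sym[OF uv] by blast
    then show "(u, v) \<in> congr ?F" using congr_base congr_sym by blast
  qed
  then have "sdeg_kernel c \<subseteq> congr ?F" using gen congr_subset by blast
  moreover have "congr ?F \<subseteq> sdeg_kernel c"
    using indispensable_pairs_subset_kernel by (intro congr_subset_kernel) auto
  ultimately have "ideal_gen (binom_of ` ?F) = (semigroup_ideal c :: ('v, 'k) mpoly set)"
    by (auto simp: ideal_gen_binom_of_eq_iff)
  moreover have "binom_of ` ?F \<subseteq> B" by (auto simp: E_def)
  ultimately have "B = binom_of ` ?F"
    using B(1) unfolding minimal_generating_set_def by (simp add: psubset_eq) blast
  with f(1) obtain u v where uv: "(u, v) \<in> indispensable_pairs c" "f = binom_of (u, v)" by force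
  then have "u \<noteq> v" by (simp add: indispensable_pairs_iff)
  then have "sdeg c u = m" using f(3) uv(2) by (simp add: homogeneous_binom_of_iff)
  with uv that show ?thesis by blast
qed

lemma degree_mem_betti:
  fixes c :: "'v::finite \<Rightarrow> 'a::comm_monoid_add"
  assumes "congr R = sdeg_kernel c" and "\<And>p. p \<in> R \<Longrightarrow> congr (R - {p}) \<noteq> sdeg_kernel c"
    and uv: "(u, v) \<in> R"
  shows "sdeg c u \<in> betti TYPE('k::field) c"
proof -
  have deg: "sdeg c p = sdeg c q" if "(p, q) \<in> R" for p q
    using that subset_kernel_if_congr_eq[OF assms(1)] by (auto simp: sdeg_kernel_def)
  \<comment> \<open>A diagonal pair could always be dropped, so irredundancy makes all the binomials
    nonzero.\<close>
  have neq: "p \<noteq> q" if "(p, q) \<in> R" for p q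
  proof
    assume "p = q"
    have "R \<subseteq> congr (R - {(p, q)})"
    proof (rule subrelI)
      fix x y assume "(x, y) \<in> R"
      then show "(x, y) \<in> congr (R - {(p, q)})"
        using \<open>p = q\<close> by (cases "x = y") (auto intro: congr.refl congr_base)
    qed
    then have "congr (R - {(p, q)}) = congr R"
      by (intro equalityI congr_subset congr_mono) auto
    then show False using assms that by blast
  qed
  have hom: "homogeneous c (sdeg c p) (binom_of (p, q) :: ('v, 'k) mpoly)" if "(p, q) \<in> R" for p q
    using deg[OF that] neq[OF that] by (simp add: homogeneous_binom_of_iff)
  have "(binom_of (u, v) :: ('v, 'k) mpoly) \<noteq> 0" using neq uv by (simp add: binom_of_eq_zero_iff)
  moreover have "\<forall>g\<in>binom_of ` R. is_binomial g \<and> (\<exists>n. homogeneous c n (g :: ('v, 'k) mpoly))"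
    using hom by (fastforce simp: is_binomial_iff)
  ultimately show ?thesis
    using minimal_generating_set_binom_of[OF assms(1,2), where ?'k = 'k] hom[OF uv] uv
    unfolding betti_def by blast
qed

section \<open>Gluings\<close>

text \<open>Two injections with complementary ranges replace \<open>Inl\<close> and
  \<open>Inr\<close>. The setting is then symmetric, and each fact about the left part can be reused
  for the right part.\<close>

locale gluing =
  fixes c :: "'v::finite \<Rightarrow> 'a::comm_monoid_add"
    and \<iota> :: "'x::finite \<Rightarrow> 'v" and \<kappa> :: "'y::finite \<Rightarrow> 'v"
    and \<gamma> :: "'x expo" and \<delta> :: "'y expo"
  assumes inj_left: "inj \<iota>" and inj_right: "inj \<kappa>"
    and disjoint: "range \<iota> \<inter> range \<kappa> = {}" and cover: "range \<iota> \<union> range \<kappa> = UNIV"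
    and cancel: "cancel_grading c"
    and sdeg_eq_zero: "\<And>\<alpha>. sdeg c \<alpha> = 0 \<Longrightarrow> \<alpha> = 0"
    and glue_degree: "sdeg (c \<circ> \<iota>) \<gamma> = sdeg (c \<circ> \<kappa>) \<delta>"
    and nonzero: "\<gamma> \<noteq> 0" "\<delta> \<noteq> 0"
begin

declare comp_apply [simp del]

text \<open>Exponent pairs of generators of I_{S_1} + I_{S_2} plus the glued binomial. The
  generators of both parts are parameters so that single ones can be removed later.\<close>

definition glue :: "('x expo \<times> 'x expo) set \<Rightarrow> ('y expo \<times> 'y expo) set \<Rightarrow> ('v expo \<times> 'v expo) set" where
  "glue R1 R2 = map_prod (push \<iota>) (push \<iota>) ` R1 \<union> map_prod (push \<kappa>) (push \<kappa>) ` R2 \<union>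
     {(push \<iota> \<gamma>, push \<kappa> \<delta>)}"

abbreviation left :: "'v expo \<Rightarrow> 'x expo" where "left \<equiv> Poly_Mapping.map_key \<iota>"

abbreviation right :: "'v expo \<Rightarrow> 'y expo" where "right \<equiv> Poly_Mapping.map_key \<kappa>"

lemma left_right_simps [simp]:
  "left (push \<iota> x) = x" "right (push \<kappa> y) = y" "left (push \<kappa> y) = 0" "right (push \<iota> x) = 0"
  "left (z + z') = left z + left z'" "right (z + z') = right z + right z'"
  using map_key_push_disjoint[OF inj_left disjoint]
    map_key_push_disjoint[OF inj_right, of \<iota>] disjoint
  by (auto simp: inj_left inj_right map_key_plus Int_commute)

lemma decompose: "z = push \<iota> (left z) + push \<kappa> (right z)"
proof (rule poly_mapping_eqI)
  fix k
  consider x where "k = \<iota> x" | y where "k = \<kappa> y" using cover by blast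
  then show "Poly_Mapping.lookup z k = Poly_Mapping.lookup (push \<iota> (left z) + push \<kappa> (right z)) k"
  proof cases
    case 1
    then have "k \<notin> Poly_Mapping.keys (push \<kappa> (right z))"
      using keys_push[of \<kappa> "right z"] disjoint by blast
    with 1 show ?thesis
      by (simp add: lookup_add lookup_push inj_left map_key.rep_eq in_keys_iff comp_apply)
  next
    case 2
    then have "k \<notin> Poly_Mapping.keys (push \<iota> (left z))"
      using keys_push[of \<iota> "left z"] disjoint by blast
    with 2 show ?thesis
      by (simp add: lookup_add lookup_push inj_right map_key.rep_eq in_keys_iff comp_apply)
  qed
qed

lemma sdeg_left_right: "sdeg c z = sdeg (c \<circ> \<iota>) (left z) + sdeg (c \<circ> \<kappa>) (right z)"
  using arg_cong[OF decompose[of z], of "sdeg c"] by (simp add: sdeg_add sdeg_push)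

lemma sdeg_right_eq_zero: "sdeg (c \<circ> \<kappa>) y = 0 \<Longrightarrow> y = 0"
  using sdeg_eq_zero[of "push \<kappa> y"] push_eq_iff[OF inj_right, of y 0] by (simp add: sdeg_push)

lemma sdeg_right_cancel:
  "sdeg (c \<circ> \<kappa>) x + sdeg (c \<circ> \<kappa>) y = sdeg (c \<circ> \<kappa>) x + sdeg (c \<circ> \<kappa>) z \<Longrightarrow>
     sdeg (c \<circ> \<kappa>) y = sdeg (c \<circ> \<kappa>) z"
  using cancel by (simp add: cancel_grading_def flip: sdeg_push)

text \<open>Here \<open>n\<close> is the number of times the glued pair has been used from left to right, minus
  the number of times it has been used from right to left.\<close>

lemma congr_glue_invariant:
  assumes "(x, z) \<in> congr (glue R1 R2)" and "R2 \<subseteq> sdeg_kernel (c \<circ> \<kappa>)" and "right x = 0"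
  shows "\<exists>n::nat. sdeg (c \<circ> \<kappa>) (right z) = sdeg (c \<circ> \<kappa>) (\<Sum>_<n. \<delta>) \<and>
    (left x, left z + (\<Sum>_<n. \<gamma>)) \<in> congr R1"
  using assms
proof (induction rule: congr.induct)
  case (refl x)
  then show ?case by (intro exI[of _ 0]) (auto intro: congr.refl)
next
  case (forward x u w v)
  then obtain n :: nat where n: "sdeg (c \<circ> \<kappa>) (right (u + w)) = sdeg (c \<circ> \<kappa>) (\<Sum>_<n. \<delta>)"
      "(left x, left (u + w) + (\<Sum>_<n. \<gamma>)) \<in> congr R1"
    by blast
  from forward(2) consider (left) p q where "(p, q) \<in> R1" "u = push \<iota> p" "v = push \<iota> q"
    | (right) p q where "(p, q) \<in> R2" "u = push \<kappa> p" "v = push \<kappa> q"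
    | (glue) "u = push \<iota> \<gamma>" "v = push \<kappa> \<delta>"
    unfolding glue_def by auto
  then show ?case
  proof cases
    case left
    then show ?thesis
      using n congr.forward[of "left x" p "left w + (\<Sum>_<n. \<gamma>)" R1 q]
      by (intro exI[of _ n]) (simp add: ac_simps)
  next
    case right
    then have "sdeg (c \<circ> \<kappa>) p = sdeg (c \<circ> \<kappa>) q" using assms(2) by (auto simp: sdeg_kernel_def)
    then show ?thesis using right n by (intro exI[of _ n]) (simp add: sdeg_add)
  next
    case glue
    \<comment> \<open>The move takes one \<open>\<gamma>\<close> from the left part and adds one
      \<open>\<delta>\<close> to the right part; the count \<open>Suc n\<close> restores the
      balance.\<close>
    then show ?thesis using n by (intro exI[of _ "Suc n"]) (simp add: sdeg_add ac_simps)
  qed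
next
  case (backward x v w u)
  then obtain n :: nat where n: "sdeg (c \<circ> \<kappa>) (right (v + w)) = sdeg (c \<circ> \<kappa>) (\<Sum>_<n. \<delta>)"
      "(left x, left (v + w) + (\<Sum>_<n. \<gamma>)) \<in> congr R1"
    by blast
  from backward(2) consider (left) p q where "(p, q) \<in> R1" "u = push \<iota> p" "v = push \<iota> q"
    | (right) p q where "(p, q) \<in> R2" "u = push \<kappa> p" "v = push \<kappa> q"
    | (glue) "u = push \<iota> \<gamma>" "v = push \<kappa> \<delta>"
    unfolding glue_def by auto
  then show ?case
  proof cases
    case left
    then show ?thesis
      using n congr.backward[of "left x" q "left w + (\<Sum>_<n. \<gamma>)" R1 p]
      by (intro exI[of _ n]) (simp add: ac_simps)
  next
    case right
    then have "sdeg (c \<circ> \<kappa>) p = sdeg (c \<circ> \<kappa>) q" using assms(2) by (auto simp: sdeg_kernel_def)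
    then show ?thesis using right n by (intro exI[of _ n]) (simp add: sdeg_add)
  next
    case glue
    \<comment> \<open>The count cannot become negative: the right part contains
      \<open>\<delta>\<close>, which has nonzero degree, whereas \<open>n = 0\<close> would give it
      degree 0.\<close>
    have "n \<noteq> 0"
    proof
      assume "n = 0"
      then have "\<delta> + right w = 0" using n(1) glue by (simp add: sdeg_right_eq_zero)
      then have "Poly_Mapping.lookup \<delta> y + Poly_Mapping.lookup (right w) y = 0" for y
        by (metis lookup_add lookup_zero)
      then have "\<delta> = 0" by (intro poly_mapping_eqI) simp
      with nonzero show False by simp
    qed
    then obtain m where m: "n = Suc m" by (cases n) auto
    have "sdeg (c \<circ> \<kappa>) \<delta> + sdeg (c \<circ> \<kappa>) (right w) =
        sdeg (c \<circ> \<kappa>) \<delta> + sdeg (c \<circ> \<kappa>) (\<Sum>_<m. \<delta>)"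
      using n(1) glue m by (simp add: sdeg_add ac_simps)
    from sdeg_right_cancel[OF this] show ?thesis
      using n(2) glue m by (intro exI[of _ m]) (simp add: ac_simps)
  qed
qed

text \<open>The right part is trivial at the end of the chain, so its degree, that of
  \<open>n\<close> copies of \<open>\<delta>\<close>, is zero. This forces \<open>n = 0\<close>, and
  the invariant is then a statement about \<open>R1\<close> alone.\<close>

lemma congr_glue_left:
  assumes "(push \<iota> x, push \<iota> y) \<in> congr (glue R1 R2)" and "R2 \<subseteq> sdeg_kernel (c \<circ> \<kappa>)"
  shows "(x, y) \<in> congr R1"
proof -
  obtain n :: nat where n: "sdeg (c \<circ> \<kappa>) (\<Sum>_<n. \<delta>) = 0" "(x, y + (\<Sum>_<n. \<gamma>)) \<in> congr R1"
    using congr_glue_invariant[OF assms] by auto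
  have "n = 0"
  proof (cases n)
    case (Suc m)
    have "Poly_Mapping.lookup ((\<Sum>_<m. \<delta>) + \<delta>) y = 0" for y
      using sdeg_right_eq_zero[OF n(1)] Suc by (simp add: lookup_zero ac_simps)
    then have "\<delta> = 0" by (intro poly_mapping_eqI) (simp add: lookup_add)
    with nonzero show ?thesis by simp
  qed
  with n show ?thesis by simp
qed

text \<open>All other generators preserve the degree of the right part, while the glued pair raises
  it from zero to a nonzero value.\<close>

lemma glued_pair_not_redundant:
  assumes "R2 \<subseteq> sdeg_kernel (c \<circ> \<kappa>)"
  shows "(push \<iota> \<gamma>, push \<kappa> \<delta>) \<notin> congr (glue R1 R2 - {(push \<iota> \<gamma>, push \<kappa> \<delta>)})"
proof
  have step: "sdeg (c \<circ> \<kappa>) (right u) = sdeg (c \<circ> \<kappa>) (right v)"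
    if "(u, v) \<in> glue R1 R2 - {(push \<iota> \<gamma>, push \<kappa> \<delta>)}" for u v
    using that assms by (auto simp: glue_def sdeg_kernel_def)
  have "sdeg (c \<circ> \<kappa>) (right x) = sdeg (c \<circ> \<kappa>) (right y)"
    if "(x, y) \<in> congr (glue R1 R2 - {(push \<iota> \<gamma>, push \<kappa> \<delta>)})" for x y
    using that
  proof (induction rule: congr.induct)
    case (forward x u w v)
    then show ?case using step[OF forward(2)] by (simp add: sdeg_add)
  next
    case (backward x v w u)
    then show ?case using step[OF backward(2)] by (simp add: sdeg_add)
  qed simp
  moreover assume "(push \<iota> \<gamma>, push \<kappa> \<delta>) \<in> congr (glue R1 R2 - {(push \<iota> \<gamma>, push \<kappa> \<delta>)})"
  ultimately have "sdeg (c \<circ> \<kappa>) \<delta> = 0" by fastforce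
  then show False using sdeg_right_eq_zero nonzero by blast
qed

text \<open>Exchanging the sides only reverses the glued pair, which leaves the congruence
  unchanged.\<close>

lemma congr_glue_swap:
  "congr (glue R1 R2) = congr (map_prod (push \<kappa>) (push \<kappa>) ` R2 \<union>
     map_prod (push \<iota>) (push \<iota>) ` R1 \<union> {(push \<kappa> \<delta>, push \<iota> \<gamma>)})" (is "_ = congr ?R")
proof (intro equalityI congr_subset)
  have "(push \<kappa> \<delta>, push \<iota> \<gamma>) \<in> congr ?R" "(push \<iota> \<gamma>, push \<kappa> \<delta>) \<in> congr (glue R1 R2)"
    by (auto simp: glue_def intro: congr_base)
  then have "(push \<iota> \<gamma>, push \<kappa> \<delta>) \<in> congr ?R" "(push \<kappa> \<delta>, push \<iota> \<gamma>) \<in> congr (glue R1 R2)"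
    using congr_sym by blast+
  then show "glue R1 R2 \<subseteq> congr ?R" "?R \<subseteq> congr (glue R1 R2)"
    using congr_superset[of ?R] congr_superset[of "glue R1 R2"]
    by (simp_all add: glue_def)
qed

definition left_part :: "('v expo \<times> 'v expo) set \<Rightarrow> ('x expo \<times> 'x expo) set" where
  "left_part R = {(x, y). (push \<iota> x, push \<iota> y) \<in> R}"

text \<open>An X-monomial of the given degree is in particular a monomial of that degree in all
  indeterminates, so uniqueness restricts to the left part.\<close>

lemma left_part_indispensable: "left_part (indispensable_pairs c) \<subseteq> indispensable_pairs (c \<circ> \<iota>)"
proof (rule subrelI)
  fix x y assume "(x, y) \<in> left_part (indispensable_pairs c)"
  then have *: "(push \<iota> x, push \<iota> y) \<in> indispensable_pairs c" by (simp add: left_part_def)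
  have keys: "Poly_Mapping.keys x \<inter> Poly_Mapping.keys y = {}"
  proof -
    have "\<iota> i \<notin> Poly_Mapping.keys (push \<iota> x) \<inter> Poly_Mapping.keys (push \<iota> y)" for i
      using * by (simp add: indispensable_pairs_iff)
    then show ?thesis by (auto simp: in_keys_iff lookup_push inj_left)
  qed
  have "sdeg c (push \<iota> z) = sdeg c (push \<iota> x) \<longleftrightarrow> push \<iota> z = push \<iota> x \<or> push \<iota> z = push \<iota> y" for z
    using * unfolding indispensable_pairs_iff by blast
  then have "sdeg (c \<circ> \<iota>) z = sdeg (c \<circ> \<iota>) x \<longleftrightarrow> z = x \<or> z = y" for z
    by (simp add: sdeg_push push_eq_iff[OF inj_left])
  moreover have "x \<noteq> y" using * by (auto simp: indispensable_pairs_iff)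
  ultimately show "(x, y) \<in> indispensable_pairs (c \<circ> \<iota>)"
    using keys unfolding indispensable_pairs_iff by blast
qed

lemma gluing_swap: "gluing c \<kappa> \<iota> \<delta> \<gamma>"
  using disjoint cover glue_degree nonzero
  by unfold_locales (auto simp: inj_left inj_right cancel sdeg_eq_zero Int_commute Un_commute)

end

section \<open>Exchange of the two sides, and the passage from a gluing to its parts\<close>

sublocale gluing \<subseteq> swap: gluing c \<kappa> \<iota> \<delta> \<gamma>
  by (rule gluing_swap)

context gluing
begin

lemma congr_swap_glue: "congr (swap.glue R2 R1) = congr (glue R1 R2)"
  by (simp add: congr_glue_swap swap.glue_def)

lemma push_mem_kernel_iff [simp]:
  "(push \<iota> x, push \<iota> y) \<in> sdeg_kernel c \<longleftrightarrow> (x, y) \<in> sdeg_kernel (c \<circ> \<iota>)"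
  by (simp add: sdeg_kernel_def sdeg_push)

lemma cancel_left: "cancel_grading (c \<circ> \<iota>)"
  using cancel by (simp add: cancel_grading_def flip: sdeg_push)

lemma congr_glue_mono:
  assumes "R1 \<subseteq> congr R1'" and "R2 \<subseteq> congr R2'"
  shows "congr (glue R1 R2) \<subseteq> congr (glue R1' R2')"
proof (rule congr_subset)
  have "map_prod (push \<iota>) (push \<iota>) ` R1 \<subseteq> congr (map_prod (push \<iota>) (push \<iota>) ` R1')"
    using assms(1) congr_image_subset[of "push \<iota>" R1'] push_add by blast
  moreover have "map_prod (push \<kappa>) (push \<kappa>) ` R2 \<subseteq> congr (map_prod (push \<kappa>) (push \<kappa>) ` R2')"
    using assms(2) congr_image_subset[of "push \<kappa>" R2'] push_add by blast
  moreover have "congr (map_prod (push \<iota>) (push \<iota>) ` R1') \<subseteq> congr (glue R1' R2')"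
    "congr (map_prod (push \<kappa>) (push \<kappa>) ` R2') \<subseteq> congr (glue R1' R2')"
    by (intro congr_mono; force simp: glue_def)+
  moreover have "(push \<iota> \<gamma>, push \<kappa> \<delta>) \<in> congr (glue R1' R2')"
    by (rule congr_base) (simp add: glue_def)
  ultimately show "glue R1 R2 \<subseteq> congr (glue R1' R2')"
    unfolding glue_def[of R1 R2] by blast
qed

text \<open>Since the gluing generates, it contains an orientation of every indispensable pair. Such
  a pair therefore belongs to one part or is the glued pair.\<close>

lemma indispensable_pairs_subset_glue:
  assumes "congr (glue (sdeg_kernel (c \<circ> \<iota>)) (sdeg_kernel (c \<circ> \<kappa>))) = sdeg_kernel c"
    and "(u, v) \<in> indispensable_pairs c"
  shows "(u, v) \<in> glue (left_part (indispensable_pairs c)) (swap.left_part (indispensable_pairs c)) \<or>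
    (v, u) \<in> glue (left_part (indispensable_pairs c)) (swap.left_part (indispensable_pairs c))"
  using indispensable_pair_mem[OF assms(2,1)] assms(2) indispensable_pairs_sym[OF assms(2)]
  unfolding glue_def left_part_def swap.left_part_def by auto

text \<open>Necessity of (i). Chains of indispensable pairs of the whole between X-monomials reduce
  by \<open>congr_glue_left\<close> to pairs inside the left part, which are indispensable
  there.\<close>

lemma indispensable_generation_left:
  assumes glue: "congr (glue (sdeg_kernel (c \<circ> \<iota>)) (sdeg_kernel (c \<circ> \<kappa>))) = sdeg_kernel c"
    and gen: "congr (indispensable_pairs c) = sdeg_kernel c"
  shows "congr (indispensable_pairs (c \<circ> \<iota>)) = sdeg_kernel (c \<circ> \<iota>)"
proof
  show "congr (indispensable_pairs (c \<circ> \<iota>)) \<subseteq> sdeg_kernel (c \<circ> \<iota>)"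
    by (intro congr_subset_kernel indispensable_pairs_subset_kernel)
  let ?G = "glue (left_part (indispensable_pairs c)) (swap.left_part (indispensable_pairs c))"
  have "indispensable_pairs c \<subseteq> congr ?G"
  proof (rule subrelI)
    fix u v assume "(u, v) \<in> indispensable_pairs c"
    then have "(u, v) \<in> ?G \<or> (v, u) \<in> ?G" by (rule indispensable_pairs_subset_glue[OF glue])
    then show "(u, v) \<in> congr ?G" using congr_base[of _ _ ?G] congr_sym[of v u ?G] by blast
  qed
  then have ker: "sdeg_kernel c \<subseteq> congr ?G" using gen congr_subset by blast
  have right: "swap.left_part (indispensable_pairs c) \<subseteq> sdeg_kernel (c \<circ> \<kappa>)"
    using swap.left_part_indispensable indispensable_pairs_subset_kernel by blast
  show "sdeg_kernel (c \<circ> \<iota>) \<subseteq> congr (indispensable_pairs (c \<circ> \<iota>))"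
  proof (rule subrelI)
    fix x y assume "(x, y) \<in> sdeg_kernel (c \<circ> \<iota>)"
    then have "(push \<iota> x, push \<iota> y) \<in> congr ?G" using ker push_mem_kernel_iff by blast
    from congr_glue_left[OF this right] show "(x, y) \<in> congr (indispensable_pairs (c \<circ> \<iota>))"
      using congr_mono[OF left_part_indispensable] by blast
  qed
qed

text \<open>Necessity of (ii). Otherwise all indispensable pairs would come from the remaining
  generators of the gluing, making the glued pair redundant.\<close>

lemma glued_pair_indispensable:
  assumes glue: "congr (glue (sdeg_kernel (c \<circ> \<iota>)) (sdeg_kernel (c \<circ> \<kappa>))) = sdeg_kernel c"
    and gen: "congr (indispensable_pairs c) = sdeg_kernel c"
  shows "(push \<iota> \<gamma>, push \<kappa> \<delta>) \<in> indispensable_pairs c"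
proof (rule ccontr)
  let ?p = "(push \<iota> \<gamma>, push \<kappa> \<delta>)"
  let ?G = "glue (sdeg_kernel (c \<circ> \<iota>)) (sdeg_kernel (c \<circ> \<kappa>))"
  assume not: "?p \<notin> indispensable_pairs c"
  have "indispensable_pairs c \<subseteq> congr (?G - {?p})"
  proof (rule subrelI)
    fix u v assume uv: "(u, v) \<in> indispensable_pairs c"
    then have "(u, v) \<noteq> ?p" "(v, u) \<noteq> ?p" using not indispensable_pairs_sym[OF uv] by auto
    then have "(u, v) \<in> ?G - {?p} \<or> (v, u) \<in> ?G - {?p}"
      using indispensable_pair_mem[OF uv glue] by blast
    then show "(u, v) \<in> congr (?G - {?p})"
      using congr_base[of _ _ "?G - {?p}"] congr_sym[of v u "?G - {?p}"] by blast
  qed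
  then have "sdeg_kernel c \<subseteq> congr (?G - {?p})" using gen congr_subset by blast
  moreover have "?p \<in> sdeg_kernel c" using glue_degree by (simp add: sdeg_kernel_def sdeg_push)
  ultimately show False using glued_pair_not_redundant[OF subset_refl] by blast
qed

text \<open>Necessity of (iii). The degree contains only \<open>u\<close> and \<open>v\<close>, and
  every generator of the gluing consists of pure monomials.\<close>

lemma indispensable_pair_pure:
  assumes glue: "congr (glue (sdeg_kernel (c \<circ> \<iota>)) (sdeg_kernel (c \<circ> \<kappa>))) = sdeg_kernel c"
    and uv: "(u, v) \<in> indispensable_pairs c" and w: "sdeg c w = sdeg c u"
  shows "Poly_Mapping.keys w \<subseteq> range \<iota> \<or> Poly_Mapping.keys w \<subseteq> range \<kappa>"
proof -
  have "w = u \<or> w = v" using uv w by (simp add: indispensable_pairs_iff)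
  moreover have "z \<in> range (push \<iota>) \<union> range (push \<kappa>)" if "z = u \<or> z = v" for z
    using indispensable_pair_mem[OF uv glue] that unfolding glue_def by auto
  ultimately show ?thesis using keys_push[of \<iota>] keys_push[of \<kappa>] by fast
qed

section \<open>The passage from the parts to the gluing\<close>

lemma push_eq_pushD:
  fixes x :: "'x expo" and y :: "'y expo"
  shows "push \<iota> x = push \<kappa> y \<Longrightarrow> x = 0 \<and> y = 0"
  using left_right_simps(1,4)[of x] left_right_simps(2,3)[of y] by metis

text \<open>The only danger is a new monomial of the same degree. By \<open>pure\<close> it would be
  a pure Y-monomial, and the invariant then makes the degree a multiple \<open>n\<close> of the
  glued degree; every \<open>n\<close> is refuted.\<close>

lemma indispensable_pair_push_left:
  assumes glue: "congr (glue (sdeg_kernel (c \<circ> \<iota>)) (sdeg_kernel (c \<circ> \<kappa>))) = sdeg_kernel c"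
    and glued: "(push \<iota> \<gamma>, push \<kappa> \<delta>) \<in> indispensable_pairs c"
    and xy: "(x, y) \<in> indispensable_pairs (c \<circ> \<iota>)"
    and pure: "\<And>w. sdeg c w = sdeg c (push \<iota> x) \<Longrightarrow> left w = 0 \<or> right w = 0"
  shows "(push \<iota> x, push \<iota> y) \<in> indispensable_pairs c"
proof -
  have deg: "sdeg (c \<circ> \<iota>) z = sdeg (c \<circ> \<iota>) x \<longleftrightarrow> z = x \<or> z = y" for z
    using xy by (simp add: indispensable_pairs_iff)
  have right_zero: "right w = 0" if w: "sdeg c w = sdeg c (push \<iota> x)" for w
  proof (rule ccontr)
    assume right: "right w \<noteq> 0"
    then have left: "left w = 0" using pure w by blast
    have "(push \<iota> x, w) \<in> congr (glue (sdeg_kernel (c \<circ> \<iota>)) (sdeg_kernel (c \<circ> \<kappa>)))"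
      using w glue by (simp add: sdeg_kernel_def)
    then obtain n :: nat where n: "sdeg (c \<circ> \<kappa>) (right w) = sdeg (c \<circ> \<kappa>) (\<Sum>_<n. \<delta>)"
      using congr_glue_invariant[of "push \<iota> x" w] by fastforce
    consider "n = 0" | "n = 1" | m where "n = Suc (Suc m)" by (metis One_nat_def nat.exhaust)
    then show False
    proof cases
      case 1
      then show False using n right sdeg_right_eq_zero by simp
    next
      case 2
      \<comment> \<open>For \<open>n = 1\<close> the degree is the glued degree, whose only
        X-monomial is \<open>push \<iota> \<gamma>\<close>; hence \<open>x\<close> and
        \<open>y\<close> would coincide.\<close>
      then have "sdeg c (push \<iota> x) = sdeg c (push \<iota> \<gamma>)"
        using n w left glue_degree by (simp add: sdeg_left_right[of w] sdeg_push)
      then have "sdeg c (push \<iota> z) = sdeg c (push \<iota> \<gamma>)" if "z = x \<or> z = y" for z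
        using deg that by (simp add: sdeg_push)
      then have "push \<iota> z = push \<iota> \<gamma> \<or> push \<iota> z = push \<kappa> \<delta>" if "z = x \<or> z = y" for z
        using glued that unfolding indispensable_pairs_iff by blast
      then have "x = \<gamma> \<and> y = \<gamma>"
        using push_eq_pushD nonzero push_eq_iff[OF inj_left] by metis
      then show False using xy by (simp add: indispensable_pairs_iff)
    next
      case 3
      \<comment> \<open>Trading one of at least two copies of \<open>\<delta>\<close> for
        \<open>\<gamma>\<close> gives a mixed monomial of the same degree.\<close>
      let ?w = "push \<iota> \<gamma> + push \<kappa> (\<Sum>_<Suc m. \<delta>)"
      have "sdeg c ?w = sdeg c (push \<iota> x)"
        using n w left 3 glue_degree
        by (simp add: sdeg_left_right[of w] sdeg_push sdeg_add ac_simps)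
      then have "left ?w = 0 \<or> right ?w = 0" by (rule pure)
      then have "(\<Sum>_<Suc m. \<delta>) = 0" using nonzero by simp
      then have "Poly_Mapping.lookup ((\<Sum>_<m. \<delta>) + \<delta>) i = 0" for i by (simp add: ac_simps)
      then have "\<delta> = 0" by (intro poly_mapping_eqI) (simp add: lookup_add)
      with nonzero show False by simp
    qed
  qed
  have "sdeg c w = sdeg c (push \<iota> x) \<longleftrightarrow> w = push \<iota> x \<or> w = push \<iota> y" for w
  proof
    assume w: "sdeg c w = sdeg c (push \<iota> x)"
    then have "right w = 0" by (rule right_zero)
    then have "left w = x \<or> left w = y" using w deg by (simp add: sdeg_left_right[of w] sdeg_push)
    then show "w = push \<iota> x \<or> w = push \<iota> y" using \<open>right w = 0\<close> decompose[of w] by auto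
  next
    assume "w = push \<iota> x \<or> w = push \<iota> y"
    then show "sdeg c w = sdeg c (push \<iota> x)" using deg by (auto simp: sdeg_push)
  qed
  moreover have "push \<iota> x \<noteq> push \<iota> y"
    using xy by (simp add: indispensable_pairs_iff push_eq_iff[OF inj_left])
  moreover have "Poly_Mapping.keys (push \<iota> x) \<inter> Poly_Mapping.keys (push \<iota> y) = {}"
  proof -
    have "Poly_Mapping.keys x \<inter> Poly_Mapping.keys y = {}" using xy by (simp add: indispensable_pairs_iff)
    then have "\<iota> i \<notin> Poly_Mapping.keys (push \<iota> x) \<inter> Poly_Mapping.keys (push \<iota> y)" for i
      by (auto simp: in_keys_iff lookup_push inj_left)
    then show ?thesis using keys_push[of \<iota> x] by blast
  qed
  ultimately show ?thesis unfolding indispensable_pairs_iff by blast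
qed

text \<open>By \<open>congr_glue_left\<close> a redundancy inside the gluing would descend to the
  left part, where none exists.\<close>

lemma oriented_pair_irredundant_left:
  assumes "congr (indispensable_pairs (c \<circ> \<iota>)) = sdeg_kernel (c \<circ> \<iota>)"
    and "q \<in> oriented_pairs (c \<circ> \<iota>)" and "R2 \<subseteq> sdeg_kernel (c \<circ> \<kappa>)"
  shows "map_prod (push \<iota>) (push \<iota>) q \<notin> congr (glue (oriented_pairs (c \<circ> \<iota>) - {q}) R2)"
proof
  let ?O = "oriented_pairs (c \<circ> \<iota>)"
  assume "map_prod (push \<iota>) (push \<iota>) q \<in> congr (glue (?O - {q}) R2)"
  then have "q \<in> congr (?O - {q})"
    using congr_glue_left[OF _ assms(3), of "fst q" "snd q"] by (simp add: map_prod_def case_prod_unfold)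
  then have "?O \<subseteq> congr (?O - {q})" using congr_superset[of "?O - {q}"] by blast
  then have "congr ?O \<subseteq> congr (?O - {q})" by (rule congr_subset)
  moreover have "congr (?O - {q}) \<subseteq> congr ?O" by (rule congr_mono) blast
  ultimately show False
    using oriented_pairs_irredundant[OF assms(2)] assms(1) congr_oriented_pairs[of "c \<circ> \<iota>"] by simp
qed

text \<open>Sufficiency. The oriented pairs of both parts and the glued pair generate, and each of
  them turns out to be indispensable for the whole.\<close>

lemma congr_indispensable_pairs:
  assumes glue: "congr (glue (sdeg_kernel (c \<circ> \<iota>)) (sdeg_kernel (c \<circ> \<kappa>))) = sdeg_kernel c"
    and glued: "(push \<iota> \<gamma>, push \<kappa> \<delta>) \<in> indispensable_pairs c"
    and gen_left: "congr (indispensable_pairs (c \<circ> \<iota>)) = sdeg_kernel (c \<circ> \<iota>)"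
    and gen_right: "congr (indispensable_pairs (c \<circ> \<kappa>)) = sdeg_kernel (c \<circ> \<kappa>)"
    and pure: "\<And>w. sdeg c w \<in> betti TYPE('k::field) c \<Longrightarrow> left w = 0 \<or> right w = 0"
  shows "congr (indispensable_pairs c) = sdeg_kernel c"
proof
  show "congr (indispensable_pairs c) \<subseteq> sdeg_kernel c"
    by (intro congr_subset_kernel indispensable_pairs_subset_kernel)
  let ?O1 = "oriented_pairs (c \<circ> \<iota>)" and ?O2 = "oriented_pairs (c \<circ> \<kappa>)"
  let ?R = "glue ?O1 ?O2"
  have O1: "?O1 \<subseteq> sdeg_kernel (c \<circ> \<iota>)" and O2: "?O2 \<subseteq> sdeg_kernel (c \<circ> \<kappa>)"
    using oriented_pairs_subset indispensable_pairs_subset_kernel by fast+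
  have "congr (glue (sdeg_kernel (c \<circ> \<iota>)) (sdeg_kernel (c \<circ> \<kappa>))) \<subseteq> congr ?R"
    by (rule congr_glue_mono) (simp_all add: congr_oriented_pairs gen_left gen_right)
  moreover have "?R \<subseteq> glue (sdeg_kernel (c \<circ> \<iota>)) (sdeg_kernel (c \<circ> \<kappa>))"
    using O1 O2 by (auto simp: glue_def)
  then have "congr ?R \<subseteq> congr (glue (sdeg_kernel (c \<circ> \<iota>)) (sdeg_kernel (c \<circ> \<kappa>)))"
    by (rule congr_mono)
  ultimately have R: "congr ?R = sdeg_kernel c" using glue by simp
  have irredundant: "congr (?R - {p}) \<noteq> sdeg_kernel c" if p: "p \<in> ?R" for p
  proof
    assume eq: "congr (?R - {p}) = sdeg_kernel c"
    have mem: "p \<in> congr (?R - {p})" using p subset_kernel_if_congr_eq[OF R] eq by blast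
    consider (left) q where "q \<in> ?O1" "p = map_prod (push \<iota>) (push \<iota>) q"
      | (right) q where "q \<in> ?O2" "p = map_prod (push \<kappa>) (push \<kappa>) q"
      | (glue) "p = (push \<iota> \<gamma>, push \<kappa> \<delta>)"
      using p unfolding glue_def by (elim UnE imageE) auto
    then show False
    proof cases
      case left
      then have "congr (?R - {p}) \<subseteq> congr (glue (?O1 - {q}) ?O2)"
        by (intro congr_mono) (auto simp: glue_def)
      then show False using oriented_pair_irredundant_left[OF gen_left left(1) O2] mem left(2) by blast
    next
      case right
      then have "congr (?R - {p}) \<subseteq> congr (glue ?O1 (?O2 - {q}))"
        by (intro congr_mono) (auto simp: glue_def)
      then have "congr (?R - {p}) \<subseteq> congr (swap.glue (?O2 - {q}) ?O1)"
        by (simp only: congr_swap_glue)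
      then show False
        using gluing.oriented_pair_irredundant_left[OF gluing_swap gen_right right(1) O1] mem right(2)
        by blast
    next
      case glue
      then show False using glued_pair_not_redundant[OF O2] mem by blast
    qed
  qed
  \<comment> \<open>Irredundancy enters here: it turns the degrees of these generators into Betti
    degrees, to which \<open>pure\<close> applies.\<close>
  have betti: "sdeg c u \<in> betti TYPE('k) c" if "(u, v) \<in> ?R" for u v
    using R irredundant that by (rule degree_mem_betti)
  have "?R \<subseteq> indispensable_pairs c"
  proof (rule subrelI)
    fix u v assume uv: "(u, v) \<in> ?R"
    have pure': "left w = 0 \<or> right w = 0" if "sdeg c w = sdeg c u" for w
      using pure betti[OF uv] that by simp
    from uv consider (left) x y where "(x, y) \<in> ?O1" "u = push \<iota> x" "v = push \<iota> y"
      | (right) x y where "(x, y) \<in> ?O2" "u = push \<kappa> x" "v = push \<kappa> y"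
      | (glue) "u = push \<iota> \<gamma>" "v = push \<kappa> \<delta>"
      unfolding glue_def by auto
    then show "(u, v) \<in> indispensable_pairs c"
    proof cases
      case left
      then have "(x, y) \<in> indispensable_pairs (c \<circ> \<iota>)" using oriented_pairs_subset by blast
      from indispensable_pair_push_left[OF glue glued this] show ?thesis using left pure' by simp
    next
      case right
      then have xy: "(x, y) \<in> indispensable_pairs (c \<circ> \<kappa>)" using oriented_pairs_subset by blast
      have "congr (swap.glue (sdeg_kernel (c \<circ> \<kappa>)) (sdeg_kernel (c \<circ> \<iota>))) = sdeg_kernel c"
        using glue by (simp only: congr_swap_glue)
      from gluing.indispensable_pair_push_left[OF gluing_swap this indispensable_pairs_sym[OF glued] xy]
      show ?thesis using right pure' by blast
    next
      case glue
      then show ?thesis using glued by simp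
    qed
  qed
  then show "sdeg_kernel c \<subseteq> congr (indispensable_pairs c)" using R congr_mono by blast
qed

end

section \<open>From semigroups to gradings\<close>

lemma sdeg_mem_generated: "sdeg c \<alpha> \<in> generated (range c)"
proof (induction \<alpha> rule: poly_mapping_single_add_induct)
  case zero
  show ?case by (simp add: generated.zero)
next
  case (add v n \<alpha>)
  have "(\<Sum>_<n. c v) \<in> generated (range c)"
    by (induction n) (auto intro: generated.intros)
  with add show ?case by (simp add: sdeg_add sdeg_single generated.add)
qed

text \<open>Zero lies in every generated semigroup, so a generator 0 could be dropped.\<close>

lemma minimal_generator_nonzero:
  assumes "minimally_generated_by S A" and "x \<in> A"
  shows "x \<noteq> 0"
proof
  assume "x = 0"
  have "y \<in> generated (A - {x})" if "y \<in> generated A" for y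
    using that
  proof (induction rule: generated.induct)
    case (base y)
    then show ?case using \<open>x = 0\<close> by (cases "y = 0") (auto intro: generated.intros)
  qed (auto intro: generated.intros)
  moreover have "y \<in> generated A" if "y \<in> generated (A - {x})" for y
    using that by (induction rule: generated.induct) (auto intro: generated.intros)
  ultimately have "generated (A - {x}) = S"
    using assms(1) by (auto simp: minimally_generated_by_def)
  then show False using assms unfolding minimally_generated_by_def by blast
qed

lemma cancel_gradingI: "cancellative (generated (range c)) \<Longrightarrow> cancel_grading c"
  using sdeg_mem_generated[of c] unfolding cancellative_def cancel_grading_def by blast

text \<open>If \<open>v\<close> occurred in \<open>\<alpha>\<close>, splitting it off would give
  \<open>c v\<close> an additive inverse, so \<open>c v\<close> would be zero.\<close>

lemma sdeg_eq_zeroD: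
  assumes "reduced (generated (range c))" and "\<And>v. c v \<noteq> 0" and "sdeg c \<alpha> = 0"
  shows "\<alpha> = 0"
proof (rule poly_mapping_eqI)
  fix v
  show "Poly_Mapping.lookup \<alpha> v = Poly_Mapping.lookup 0 v"
  proof (rule ccontr)
    assume "\<not> ?thesis"
    then have "\<alpha> = Poly_Mapping.single v 1 + (\<alpha> - Poly_Mapping.single v 1)"
      by (intro poly_mapping_eqI) (auto simp: lookup_add lookup_minus lookup_single when_def)
    from arg_cong[OF this, of "sdeg c"]
    have "c v + sdeg c (\<alpha> - Poly_Mapping.single v 1) = 0"
      using assms(3) by (simp add: sdeg_add sdeg_single)
    moreover have "c v \<in> generated (range c)" by (simp add: generated.base)
    ultimately show False
      using assms(1,2) sdeg_mem_generated unfolding reduced_def by blast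
  qed
qed

section \<open>Renaming of indeterminates and the extended ideals\<close>

lemma push_push_mult:
  "push (push f) (p * q) = push (push f) p * (push (push f) q :: ('v, 'k::field) mpoly)"
proof (induction p rule: poly_mapping_single_add_induct)
  case (add k e p)
  have "push (push f) (Poly_Mapping.single k e * q)
      = Poly_Mapping.single (push f k) e * push (push f) q"
    by (induction q rule: poly_mapping_single_add_induct)
       (simp_all add: distrib_left push_add mult_single)
  with add show ?case by (simp add: distrib_right push_add)
qed simp

lemma push_push_binom_of: "push (push f) (binom_of p) = binom_of (map_prod (push f) (push f) p)"
  unfolding binom_of_def monom_def diff_conv_add_uminus single_uminus[symmetric]
  by (simp add: push_add)

lemma push_push_ideal_gen:
  assumes "p \<in> ideal_gen (binom_of ` R)"
  shows "push (push f) p \<in> ideal_gen (binom_of ` map_prod (push f) (push f) ` R)"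
  using assms
proof (induction rule: ideal.span_induct_alt)
  case base
  show ?case by (simp add: ideal.span_zero)
next
  case (step h b p)
  have "push (push f) b \<in> binom_of ` map_prod (push f) (push f) ` R"
    using step(1) by (auto simp: push_push_binom_of)
  with step(2) show ?case
    by (simp add: push_add push_push_mult ideal.span_add ideal.span_scale ideal.span_base)
qed

text \<open>All three summands in the definition of a gluing lie in the ideal of \<open>?R\<close>,
  hence so does their elementwise sum; the dictionary turns this inclusion into one of
  congruences.\<close>

lemma sdeg_kernel_subset_congr_glued:
  fixes a :: "'r::finite \<Rightarrow> 'a::comm_monoid_add" and b :: "'t::finite \<Rightarrow> 'a"
    and g :: "('r + 't, 'k::field) mpoly"
  assumes "glued_binomial a b g" and g: "g = binom_of p"
  shows "sdeg_kernel (case_sum a b) \<subseteq> congr (map_prod (push Inl) (push Inl) ` sdeg_kernel a \<union>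
    map_prod (push Inr) (push Inr) ` sdeg_kernel b \<union> {p})" (is "_ \<subseteq> congr ?R")
proof -
  let ?J = "ideal_gen (binom_of ` ?R) :: ('r + 't, 'k) mpoly set"
  have "push (push Inl) ` semigroup_ideal a \<subseteq> ?J"
  proof (rule image_subsetI)
    fix h :: "('r, 'k) mpoly" assume "h \<in> semigroup_ideal a"
    then have "push (push Inl) h \<in> ideal_gen (binom_of ` map_prod (push Inl) (push Inl) ` sdeg_kernel a)"
      unfolding semigroup_ideal_eq by (rule push_push_ideal_gen)
    then show "push (push Inl) h \<in> ?J" by (rule subsetD[OF ideal.span_mono, rotated]) auto
  qed
  moreover have "push (push Inr) ` semigroup_ideal b \<subseteq> ?J"
  proof (rule image_subsetI)
    fix h :: "('t, 'k) mpoly" assume "h \<in> semigroup_ideal b"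
    then have "push (push Inr) h \<in> ideal_gen (binom_of ` map_prod (push Inr) (push Inr) ` sdeg_kernel b)"
      unfolding semigroup_ideal_eq by (rule push_push_ideal_gen)
    then show "push (push Inr) h \<in> ?J" by (rule subsetD[OF ideal.span_mono, rotated]) auto
  qed
  moreover have "{g} \<subseteq> ?J" using g by (simp add: ideal.span_base)
  ultimately have "ideal_gen (push (push Inl) ` semigroup_ideal a) \<subseteq> ?J"
      "ideal_gen (push (push Inr) ` semigroup_ideal b) \<subseteq> ?J" "ideal_gen {g} \<subseteq> ?J"
    by (simp_all only: ideal.span_minimal ideal.subspace_span)
  then have "ideal_gen (push (push Inl) ` semigroup_ideal a) +
      ideal_gen (push (push Inr) ` semigroup_ideal b) + ideal_gen {g} \<subseteq> ?J"
    by (blast elim!: set_plus_elim intro: ideal.span_add)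
  then have "semigroup_ideal (case_sum a b) \<subseteq> ?J"
    using assms(1) by (simp add: glued_binomial_def)
  then show ?thesis unfolding semigroup_ideal_eq ideal_gen_binom_of_subset_iff .
qed

lemma pure_monomial_iff:
  "pure_monomial \<alpha> \<longleftrightarrow> Poly_Mapping.map_key Inl \<alpha> = 0 \<or> Poly_Mapping.map_key Inr \<alpha> = 0"
proof -
  have "Poly_Mapping.keys \<alpha> \<subseteq> range Inl \<longleftrightarrow> Inr -` Poly_Mapping.keys \<alpha> = {}"
    by (auto simp: image_iff) (metis sum.exhaust vimageI empty_iff)
  moreover have "Poly_Mapping.keys \<alpha> \<subseteq> range Inr \<longleftrightarrow> Inl -` Poly_Mapping.keys \<alpha> = {}"
    by (auto simp: image_iff) (metis sum.exhaust vimageI empty_iff)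
  ultimately show ?thesis
    by (auto simp: pure_monomial_def simp flip: keys_map_key keys_eq_empty)
qed

theorem corollary7:
  fixes S :: "'a::comm_monoid_add set"
    and a :: "'r::finite \<Rightarrow> 'a" and b :: "'t::finite \<Rightarrow> 'a"
    and \<gamma>X :: "'r expo" and \<gamma>Y :: "'t expo"
    and g :: "('r + 't, 'k::field) mpoly" and d :: 'a
  assumes "cancellative S" and "reduced S"
    and "inj a" and "inj b" and "range a \<inter> range b = {}"
    and "minimally_generated_by S (range a \<union> range b)"
    and "is_gluing TYPE('k) a b"
    and "g = monom (push Inl \<gamma>X) - monom (push Inr \<gamma>Y)"
    and "glued_binomial a b g"
    and "homogeneous (case_sum a b) d g"
  shows "minimally_generated_by_indispensables
           (semigroup_ideal (case_sum a b) :: ('r + 't, 'k) mpoly set) \<longleftrightarrow>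
         minimally_generated_by_indispensables (semigroup_ideal a :: ('r, 'k) mpoly set) \<and>
         minimally_generated_by_indispensables (semigroup_ideal b :: ('t, 'k) mpoly set) \<and>
         indispensable (semigroup_ideal (case_sum a b)) g \<and>
         (\<forall>d'\<in>betti TYPE('k) (case_sum a b).
            \<forall>\<alpha>\<in>monomials_of_degree (case_sum a b) d'. pure_monomial \<alpha>)"
proof -
  let ?c = "case_sum a b"
  have range: "range ?c = range a \<union> range b" by (simp add: UNIV_sum image_Un image_image)
  then have S: "S = generated (range ?c)"
    using assms(6) by (simp add: minimally_generated_by_def)
  have nonzero: "?c v \<noteq> 0" for v
    using minimal_generator_nonzero[OF assms(6)] range rangeI[of ?c v] by metis
  have cancel: "cancel_grading ?c" using assms(1) S by (simp add: cancel_gradingI)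
  have positive: "\<alpha> = 0" if "sdeg ?c \<alpha> = 0" for \<alpha>
    using sdeg_eq_zeroD[of ?c] assms(2) S nonzero that by blast
  let ?p = "(push Inl \<gamma>X, push Inr \<gamma>Y) :: ('r + 't) expo \<times> ('r + 't) expo"
  have g: "g = binom_of ?p" using assms(8) by (simp add: binom_of_def)
  have "g \<in> semigroup_ideal ?c" "g \<noteq> 0" using assms(9) unfolding glued_binomial_def by blast+
  then have p: "?p \<in> sdeg_kernel ?c" "push Inl \<gamma>X \<noteq> (push Inr \<gamma>Y :: ('r + 't) expo)"
    using g by (simp_all add: binom_of_mem_semigroup_ideal_iff binom_of_eq_zero_iff)
  have deg: "sdeg a \<gamma>X = sdeg b \<gamma>Y"
    using p(1) by (simp add: sdeg_kernel_def sdeg_push case_sum_o_inj)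
  \<comment> \<open>If one exponent vector were zero, the common degree would be zero, both
    monomials would be 1 and \<open>g\<close> would vanish.\<close>
  have "\<gamma>X \<noteq> 0" "\<gamma>Y \<noteq> 0"
    using p positive[of "push Inl \<gamma>X"] positive[of "push Inr \<gamma>Y"]
    by (auto simp: sdeg_kernel_def)
  then interpret gluing ?c Inl Inr \<gamma>X \<gamma>Y
    using cancel positive deg
    by unfold_locales (auto simp: case_sum_o_inj UNIV_sum)
  have glue: "congr (glue (sdeg_kernel (?c \<circ> Inl)) (sdeg_kernel (?c \<circ> Inr))) = sdeg_kernel ?c"
  proof
    show "congr (glue (sdeg_kernel (?c \<circ> Inl)) (sdeg_kernel (?c \<circ> Inr))) \<subseteq> sdeg_kernel ?c"
      using p(1) by (intro congr_subset_kernel) (auto simp: glue_def sdeg_kernel_def sdeg_push)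
    show "sdeg_kernel ?c \<subseteq> congr (glue (sdeg_kernel (?c \<circ> Inl)) (sdeg_kernel (?c \<circ> Inr)))"
      using sdeg_kernel_subset_congr_glued[OF assms(9) g] by (simp add: glue_def case_sum_o_inj)
  qed
  then have swap: "congr (swap.glue (sdeg_kernel (?c \<circ> Inr)) (sdeg_kernel (?c \<circ> Inl))) = sdeg_kernel ?c"
    by (simp only: congr_swap_glue)
  have cancel_parts: "cancel_grading a" "cancel_grading b"
    using cancel_left gluing.cancel_left[OF gluing_swap] by (simp_all add: case_sum_o_inj)
  have indispensable_g: "indispensable (semigroup_ideal ?c) g \<longleftrightarrow> ?p \<in> indispensable_pairs ?c"
  proof
    assume "indispensable (semigroup_ideal ?c) g"
    then obtain u v where uv: "(u, v) \<in> indispensable_pairs ?c" "g = binom_of (u, v)"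
      by (auto simp: indispensable_iff[OF cancel])
    then have "const 1 * binom_of ?p = (binom_of (u, v) :: ('r + 't, 'k) mpoly)" using g by simp
    \<comment> \<open>In characteristic 2 a binomial does not determine the order of its exponents,
      so the pairs are matched only up to orientation.\<close>
    from const_mult_binom_of_eqD[OF this p(2)] show "?p \<in> indispensable_pairs ?c"
      using uv(1) indispensable_pairs_sym[OF uv(1)] by auto
  qed (use g in \<open>simp add: indispensable_iff[OF cancel]\<close>)
  \<comment> \<open>These equivalences remove the polynomial ring from every condition except the
    one on Betti degrees.\<close>
  note iffs = minimally_generated_by_indispensables_iff[OF cancel]
    cancel_parts[THEN minimally_generated_by_indispensables_iff] indispensable_g
  show ?thesis
    unfolding iffs
  proof (intro iffI conjI ballI)
    assume gen: "congr (indispensable_pairs ?c) = sdeg_kernel ?c"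
    show "congr (indispensable_pairs a) = sdeg_kernel a"
      using indispensable_generation_left[OF glue gen] by (simp add: case_sum_o_inj)
    show "congr (indispensable_pairs b) = sdeg_kernel b"
      using gluing.indispensable_generation_left[OF gluing_swap swap gen] by (simp add: case_sum_o_inj)
    show "?p \<in> indispensable_pairs ?c" using glue gen by (rule glued_pair_indispensable)
    fix d' \<alpha> assume "d' \<in> betti TYPE('k) ?c" and \<alpha>: "\<alpha> \<in> monomials_of_degree ?c d'"
    then obtain u v where "(u, v) \<in> indispensable_pairs ?c" "sdeg ?c u = d'"
      by (metis betti_degree_indispensable[OF gen])
    then show "pure_monomial \<alpha>"
      using indispensable_pair_pure[OF glue] \<alpha>
      by (simp add: pure_monomial_def monomials_of_degree_def)
  next
    assume *: "congr (indispensable_pairs a) = sdeg_kernel a \<and>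
      congr (indispensable_pairs b) = sdeg_kernel b \<and> ?p \<in> indispensable_pairs ?c \<and>
      (\<forall>d'\<in>betti TYPE('k) ?c. \<forall>\<alpha>\<in>monomials_of_degree ?c d'. pure_monomial \<alpha>)"
    show "congr (indispensable_pairs ?c) = sdeg_kernel ?c"
    proof (rule congr_indispensable_pairs[OF glue])
      show "Poly_Mapping.map_key Inl w = 0 \<or> Poly_Mapping.map_key Inr w = 0"
        if "sdeg ?c w \<in> betti TYPE('k) ?c" for w
        using * that by (simp add: monomials_of_degree_def flip: pure_monomial_iff)
    qed (use * in \<open>simp_all add: case_sum_o_inj\<close>)
  qed
qed

end
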